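(* Let $f\in\mathfrak{X}$ be such that its period map $p_f$ is locally nonconstant, and consider the delay differential equation (DDE) $$\dot x(t)=f(x(t),x(t-1)).$$ Then any periodic solution $x^\ast(t)$ of the DDE has (not necessarily minimal) period $4$ and satisfies $x^\ast(t-2)=-x^\ast(t)$ for all $t\in\mathbb{R}$. More precisely, let $\bar x:=\max_{t\in[0,4]}x^\ast(t)$ be the amplitude of $x^\ast(t)$. Then the minimal period of $x^\ast(t)$ is $p_f(\bar x)$, and it satisfies: $$p_f(\bar x)=\frac{4}{4n-1}\ \text{ for some } n\in\mathbb{N},\quad\text{if } f\in\mathfrak{X}^+,$$ $$p_f(\bar x)=\frac{4}{4n-3}\ \text{ for some } n\in\mathbb{N},\quad\text{if } f\in\mathfrak{X}^-.$$ Conversely, let $(u_1^\ast(t),u_2^\ast(t))$ be a periodic solution of the ODEs $$\dot u_1=f(u_1,u_2),\qquad \dot u_2=-f(u_2,u_1)$$ with amplitude $a:=\max_{t\in\mathbb{R}}u_1^\ast(t)$. If $f\in\mathfrak{X}^+$ and $p_f(a)=4/(4n-1)$ for some $n\in\mathbb{N}$ (respectively, $f\in\mathfrak{X}^-$ and $p_f(a)=4/(4n-3)$ for some $n\in\mathbb{N}$), then $u_1^\ast(t)$ is a periodic solution of the DDE.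
   Context: $\mathbb{N}=\{1,2,3,\dots\}$. $\mathfrak{X}^+$ is the set of all $f\in C^2(\mathbb{R}^2,\mathbb{R})$ such that $f(u_1,u_2)=f(-u_1,u_2)$, $f(u_1,u_2)=-f(u_1,-u_2)$ and $\partial_2 f(u_1,u_2)>0$ for all $(u_1,u_2)\in\mathbb{R}^2$, where $\partial_2$ is the partial derivative in the second component. $\mathfrak{X}^-:=-\mathfrak{X}^+=\{-f: f\in\mathfrak{X}^+\}$ and $\mathfrak{X}:=\mathfrak{X}^+\cup\mathfrak{X}^-$. A periodic solution of the DDE is a nonconstant differentiable function $x^\ast:\mathbb{R}\to\mathbb{R}$ satisfying the DDE for all $t\in\mathbb{R}$, for which there is $p>0$ with $x^\ast(t+p)=x^\ast(t)$ for all $t\in\mathbb{R}$. Any such $p$ is a period and the smallest one is the minimal period. Periodic solutions of the ODEs are likewise nonconstant. Period map: for $f\in\mathfrak{X}$ and $a>0$, the solution $(u_1(t;a),u_2(t;a))$ of the ODEs $\dot u_1=f(u_1,u_2)$, $\dot u_2=-f(u_2,u_1)$ with initial condition $(a,0)$ at $t=0$ is periodic; $p_f(a)$ denotes its minimal period. The map $p_f:(0,\infty)\to\mathbb{R}$ is called the period map of $f$. It is called locally nonconstant at $a>0$ if it is not constant on any interval $I$ (of positive length) with $a\in I\subset(0,\infty)$, and locally nonconstant if it is locally nonconstant at all $a>0$. *)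

theory Defs
  imports "HOL-Analysis.Analysis"
begin

text \<open>Twice continuously Frechet differentiable on the whole space.\<close>

definition C2 :: "('a::real_normed_vector \<Rightarrow> 'b::real_normed_vector) \<Rightarrow> bool" where
  "C2 f \<longleftrightarrow> (\<exists>(f' :: 'a \<Rightarrow> 'a \<Rightarrow>\<^sub>L 'b) (f'' :: 'a \<Rightarrow> 'a \<Rightarrow>\<^sub>L ('a \<Rightarrow>\<^sub>L 'b)).
     (\<forall>u. (f has_derivative blinfun_apply (f' u)) (at u)) \<and>
     (\<forall>u. (f' has_derivative blinfun_apply (f'' u)) (at u)) \<and>
     continuous_on UNIV f'')"

definition X_plus :: "(real \<times> real \<Rightarrow> real) set" where
  "X_plus = {f. C2 f \<and>
     (\<forall>u\<^sub>1 u\<^sub>2. f (u\<^sub>1, u\<^sub>2) = f (- u\<^sub>1, u\<^sub>2) \<and>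
              f (u\<^sub>1, u\<^sub>2) = - f (u\<^sub>1, - u\<^sub>2) \<and>
              deriv (\<lambda>v. f (u\<^sub>1, v)) u\<^sub>2 > 0)}"

definition X_minus :: "(real \<times> real \<Rightarrow> real) set" where
  "X_minus = {(\<lambda>u. - f u) | f. f \<in> X_plus}"

definition X_class :: "(real \<times> real \<Rightarrow> real) set" where
  "X_class = X_plus \<union> X_minus"

definition has_period :: "(real \<Rightarrow> 'a) \<Rightarrow> real \<Rightarrow> bool" where
  "has_period x p \<longleftrightarrow> 0 < p \<and> (\<forall>t. x (t + p) = x t)"

definition has_minimal_period :: "(real \<Rightarrow> 'a) \<Rightarrow> real \<Rightarrow> bool" where
  "has_minimal_period x p \<longleftrightarrow> has_period x p \<and> (\<forall>q. has_period x q \<longrightarrow> p \<le> q)"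

definition maximum_on :: "real set \<Rightarrow> (real \<Rightarrow> real) \<Rightarrow> real" where
  "maximum_on S x = (GREATEST v. v \<in> x ` S)"

definition DDE_periodic_solution :: "(real \<times> real \<Rightarrow> real) \<Rightarrow> (real \<Rightarrow> real) \<Rightarrow> bool" where
  "DDE_periodic_solution f x \<longleftrightarrow>
     (\<forall>t. (x has_real_derivative f (x t, x (t - 1))) (at t)) \<and>
     \<not> x constant_on UNIV \<and> (\<exists>p. has_period x p)"

definition ODE_solution ::
    "(real \<times> real \<Rightarrow> real) \<Rightarrow> (real \<Rightarrow> real) \<Rightarrow> (real \<Rightarrow> real) \<Rightarrow> bool" where
  "ODE_solution f u\<^sub>1 u\<^sub>2 \<longleftrightarrow>
     (\<forall>t. (u\<^sub>1 has_real_derivative f (u\<^sub>1 t, u\<^sub>2 t)) (at t) \<and>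
          (u\<^sub>2 has_real_derivative - f (u\<^sub>2 t, u\<^sub>1 t)) (at t))"

definition ODE_periodic_solution ::
    "(real \<times> real \<Rightarrow> real) \<Rightarrow> (real \<Rightarrow> real) \<Rightarrow> (real \<Rightarrow> real) \<Rightarrow> bool" where
  "ODE_periodic_solution f u\<^sub>1 u\<^sub>2 \<longleftrightarrow>
     ODE_solution f u\<^sub>1 u\<^sub>2 \<and>
     \<not> (\<lambda>t. (u\<^sub>1 t, u\<^sub>2 t)) constant_on UNIV \<and>
     (\<exists>p. has_period (\<lambda>t. (u\<^sub>1 t, u\<^sub>2 t)) p)"

text \<open>Only meaningful for \<open>f \<in> X_class\<close> and \<open>a > 0\<close>, where the solution through
  \<open>(a, 0)\<close> exists for all times, is unique, and is nonconstant and periodic.\<close>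

definition period_map :: "(real \<times> real \<Rightarrow> real) \<Rightarrow> real \<Rightarrow> real" where
  "period_map f a = (THE p. \<exists>u\<^sub>1 u\<^sub>2. ODE_solution f u\<^sub>1 u\<^sub>2 \<and> u\<^sub>1 0 = a \<and> u\<^sub>2 0 = 0 \<and>
     has_minimal_period (\<lambda>t. (u\<^sub>1 t, u\<^sub>2 t)) p)"

text \<open>Here \<open>I\<close> may be open, closed or half-open, and \<open>a\<close> may be one of its endpoints.\<close>

definition locally_nonconstant_at :: "(real \<Rightarrow> real) \<Rightarrow> real \<Rightarrow> bool" where
  "locally_nonconstant_at p a \<longleftrightarrow>
     (\<forall>I. is_interval I \<and> (\<exists>b\<in>I. \<exists>c\<in>I. b < c) \<and> a \<in> I \<and> I \<subseteq> {0<..} \<longrightarrow>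
          \<not> p constant_on I)"

definition locally_nonconstant :: "(real \<Rightarrow> real) \<Rightarrow> bool" where
  "locally_nonconstant p \<longleftrightarrow> (\<forall>a>0. locally_nonconstant_at p a)"

end

theory Submission
  imports Defs
begin

text \<open>
  The class \<open>X_minus\<close> is reduced to \<open>X_plus\<close> by reversing time: if \<open>f = - g\<close> and \<open>x\<close> solves the
  delay equation of \<open>f\<close> with delay \<open>1\<close>, then \<open>x (- t)\<close> solves that of \<open>g\<close> with delay \<open>- 1\<close>. On periodic
  functions an advance is as good as a delay, so everything is done for \<open>g \<in> X_plus\<close> and the equation
  \<open>x' (t) = g (x t, x (t - r))\<close> with an arbitrary real \<open>r\<close>. The heart of the matter is the identity
  \<open>x (t - 2 * r) = - x t\<close> (\<open>periodic_solution_half_turn\<close>): it says that \<open>(x t, x (t - r))\<close> solves the planar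
  system.

  The basic tool is that two solutions \<open>x\<close>, \<open>y\<close> with a common period cannot meet in the plane of points
  \<open>(x t, x (t - r))\<close> unless they are equal (\<open>no_double_coincidence\<close>). Indeed, by monotonicity in the delayed
  argument, between two zeros of \<open>x - y\<close> there is a zero of the delayed difference. Both functions have
  the same number of zeros per period, so the zeros of one strictly separate those of the other and no zero is
  common. The counts are finite, since infinitely many zeros in a short interval force \<open>x - y\<close> to vanish.

  Shifts and negatives of \<open>x\<close> are solutions too. Comparing \<open>x\<close> with them, and following a coincidence
  \<open>x a = x b\<close> or \<open>x a = - x b\<close> as the shift \<open>a - b\<close> grows, shows that the motion stops only at a meeting point
  in the plane. This yields \<open>x (t + h) = - x t\<close> for half of the minimal period, \<open>h\<close> (\<open>ex_antiperiod\<close>,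
  \<open>antiperiod_half_period\<close>), and that \<open>x\<close> has one maximum and one minimum per period
  (\<open>slope_order\<close>, \<open>delayed_negative_after_max\<close>). Consequently, if the clock starts at the minimum and \<open>m\<close> is the
  zero of \<open>x\<close> in \<open>{0..h}\<close>, then \<open>x (t - r) = x (t + m)\<close>. It remains to see that \<open>2 * m = h\<close>
  (\<open>lead_eq_quarter_period\<close>). The reflection \<open>(u, v) \<mapsto> (- v, - u)\<close> reverses the planar system; if \<open>2 * m > h\<close>,
  then the curve \<open>(x t, x (t + m))\<close> winds inwards relative to the vector field of that system, its mirror image winds
  outwards, and after their common point on the antidiagonal the curve stays below its mirror image and cannot
  rise to its own maximum. The case \<open>2 * m < h\<close> is a mirror image of this one.

  For the planar system itself, uniqueness and the reflections show that every periodic solution of minimal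
  period \<open>p\<close> satisfies \<open>u\<^sub>2 t = u\<^sub>1 (t + p / 4)\<close> (\<open>ODE_quarter_period\<close>). Hence \<open>u\<^sub>2 t = u\<^sub>1 (t - r)\<close> exactly when
  \<open>r + p / 4\<close> is a multiple of \<open>p\<close>; for \<open>r = 1\<close> and \<open>r = - 1\<close> these are the two resonance conditions, which gives
  both directions of the theorem.
\<close>

section \<open>Periodic functions on the line\<close>

text \<open>The number of elements of \<open>B\<close> to the left of a point increases strictly along \<open>A\<close>.\<close>

lemma card_le_of_interlacing:
  fixes A B :: "real set"
  assumes "finite B" and sep: "\<And>a a'. a \<in> A \<Longrightarrow> a' \<in> A \<Longrightarrow> a < a' \<Longrightarrow> \<exists>b\<in>B. a < b \<and> b < a'"
  shows "finite A \<and> card A \<le> card B + 1"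
proof -
  define \<phi> where "\<phi> a = card {b\<in>B. b < a}" for a
  have less: "\<phi> a < \<phi> a'" if "a \<in> A" "a' \<in> A" "a < a'" for a a'
  proof -
    obtain b where b: "b \<in> B" "a < b" "b < a'" using sep \<open>a \<in> A\<close> \<open>a' \<in> A\<close> \<open>a < a'\<close> by blast
    then have "{b\<in>B. b < a} \<subset> {b\<in>B. b < a'}" using \<open>a < a'\<close> order.strict_trans by blast
    then show ?thesis unfolding \<phi>_def using \<open>finite B\<close> by (intro psubset_card_mono) auto
  qed
  have inj: "inj_on \<phi> A"
  proof (rule inj_onI, rule ccontr)
    fix a a' assume "a \<in> A" "a' \<in> A" "\<phi> a = \<phi> a'" "a \<noteq> a'"
    then show False using less[of a a'] less[of a' a] by linarith
  qed
  have sub: "\<phi> ` A \<subseteq> {..card B}"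
    unfolding \<phi>_def using \<open>finite B\<close> by (auto intro!: card_mono)
  have "finite A" using inj sub finite_imageD finite_subset by blast
  moreover have "card A \<le> card {..card B}" using card_inj_on_le[OF inj sub] by simp
  ultimately show ?thesis by simp
qed

lemma periodic_int_shift:
  fixes x :: "real \<Rightarrow> 'a"
  assumes per: "\<And>t. x (t + p) = x t"
  shows "x (t + of_int k * p) = x t"
proof -
  have nat: "x (t + real n * p) = x t" for n t
  proof (induction n)
    case (Suc n)
    have "x (t + real (Suc n) * p) = x ((t + real n * p) + p)" by (simp add: algebra_simps)
    then show ?case using Suc per by simp
  qed simp
  show ?thesis
  proof (cases "k \<ge> 0")
    case True then show ?thesis using nat[of t "nat k"] by simp
  next
    case False
    then show ?thesis using nat[of "t + of_int k * p" "nat (-k)"] by simp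
  qed
qed

lemma representative_mod_period:
  fixes p :: real
  assumes "p > 0"
  obtains k :: int where "c \<le> s + of_int k * p" "s + of_int k * p < c + p"
proof
  let ?k = "- \<lfloor>(s - c) / p\<rfloor>"
  have "of_int \<lfloor>(s - c) / p\<rfloor> \<le> (s - c) / p" "(s - c) / p < of_int \<lfloor>(s - c) / p\<rfloor> + 1" by linarith+
  then have "of_int \<lfloor>(s - c) / p\<rfloor> * p \<le> s - c" "s - c < (of_int \<lfloor>(s - c) / p\<rfloor> + 1) * p"
    using pos_le_divide_eq[OF \<open>p > 0\<close>] pos_divide_less_eq[OF \<open>p > 0\<close>] by blast+
  then show "c \<le> s + of_int ?k * p" "s + of_int ?k * p < c + p" by (simp_all add: algebra_simps)
qed

text \<open>Translation by multiples of the period maps the zeros in one window injectively into the other window.\<close>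

lemma card_zeros_per_period:
  fixes w :: "real \<Rightarrow> real"
  assumes per: "\<And>t. w (t + p) = w t" and "p > 0"
    and fin: "finite {s\<in>{c..<c+p}. w s = 0}"
  shows "finite {s\<in>{d..<d+p}. w s = 0}" "card {s\<in>{d..<d+p}. w s = 0} \<le> card {s\<in>{c..<c+p}. w s = 0}"
proof -
  define k where "k s = (SOME k::int. c \<le> s + of_int k * p \<and> s + of_int k * p < c + p)" for s
  have k: "c \<le> s + of_int (k s) * p \<and> s + of_int (k s) * p < c + p" for s
  proof -
    obtain j :: int where "c \<le> s + of_int j * p" "s + of_int j * p < c + p"
      using representative_mod_period[OF \<open>p > 0\<close>] .
    then have "\<exists>j::int. c \<le> s + of_int j * p \<and> s + of_int j * p < c + p" by blast
    then show ?thesis unfolding k_def by (rule someI_ex)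
  qed
  define g where "g s = s + of_int (k s) * p" for s
  have inj: "inj_on g {s\<in>{d..<d+p}. w s = 0}"
  proof (rule inj_onI)
    fix s s' assume s: "s \<in> {s\<in>{d..<d+p}. w s = 0}" "s' \<in> {s\<in>{d..<d+p}. w s = 0}" and eq: "g s = g s'"
    then have "s - s' = of_int (k s' - k s) * p" by (simp add: g_def algebra_simps)
    moreover have "\<bar>s - s'\<bar> < p" using s by auto
    ultimately have "\<bar>of_int (k s' - k s) * p\<bar> < 1 * p" by simp
    then have "\<bar>real_of_int (k s' - k s)\<bar> < 1" using \<open>p > 0\<close> by (simp add: abs_mult)
    then have "k s' = k s" by linarith
    then show "s = s'" using eq by (simp add: g_def)
  qed
  have sub: "g ` {s\<in>{d..<d+p}. w s = 0} \<subseteq> {s\<in>{c..<c+p}. w s = 0}"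
  proof clarify
    fix s assume "w s = 0"
    moreover have "w (g s) = w s" unfolding g_def using periodic_int_shift[of w, OF per] .
    ultimately show "g s \<in> {c..<c+p} \<and> w (g s) = 0" using k[of s] by (simp add: g_def)
  qed
  show "finite {s\<in>{d..<d+p}. w s = 0}" using inj sub fin finite_imageD finite_subset by blast
  show "card {s\<in>{d..<d+p}. w s = 0} \<le> card {s\<in>{c..<c+p}. w s = 0}" using card_inj_on_le[OF inj sub fin] .
qed

text \<open>The infimum \<open>p\<close> of all periods is a period by continuity, unless it is \<open>0\<close>; but arbitrarily small periods bring the
  argument of \<open>x\<close> arbitrarily close to any given point and make \<open>x\<close> constant.\<close>

lemma ex_minimal_period:
  fixes x :: "real \<Rightarrow> 'a::metric_space"
  assumes cont: "continuous_on UNIV x" and nc: "\<not> x constant_on UNIV" and ex: "has_period x q"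
  obtains p where "has_minimal_period x p"
proof -
  define P where "P = {q. has_period x q}"
  define p where "p = Inf P"
  have ne: "P \<noteq> {}" and pos: "\<And>q. q \<in> P \<Longrightarrow> q > 0"
    using ex unfolding P_def has_period_def by blast+
  have bdd: "bdd_below P" by (intro bdd_belowI[of _ 0] less_imp_le[OF pos])
  have contx: "isCont x t" for t using cont by (simp add: continuous_on_eq_continuous_at)
  have lower: "p \<le> q" if "q \<in> P" for q unfolding p_def using bdd that by (rule cInf_lower[rotated])
  have approx: "\<exists>q\<in>P. q < p + e" if "e > 0" for e
    using cInf_lessD[OF ne, of "p + e"] that by (auto simp: p_def)
  have "p \<ge> 0" unfolding p_def by (rule cInf_greatest[OF ne]) (simp add: pos less_imp_le)
  have "p > 0"
  proof (rule ccontr)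
    assume "\<not> p > 0"
    then have p0: "p = 0" using \<open>p \<ge> 0\<close> by simp
    have "x t = x s" for t s
    proof (rule ccontr)
      assume "x t \<noteq> x s"
      then have "dist (x t) (x s) > 0" by simp
      then have "\<exists>d>0. \<forall>s'. dist s' s < d \<longrightarrow> dist (x s') (x s) < dist (x t) (x s)"
        using cont[unfolded continuous_on_iff, rule_format, of s "dist (x t) (x s)"] by simp
      then obtain d where d: "d > 0" "\<And>s'. dist s' s < d \<Longrightarrow> dist (x s') (x s) < dist (x t) (x s)"
        by blast
      obtain q where q: "q \<in> P" "q < d" using approx[OF d(1)] p0 by auto
      then have "q > 0" and per: "\<And>t. x (t + q) = x t" unfolding P_def has_period_def by blast+
      obtain k :: int where "s \<le> t + of_int k * q" "t + of_int k * q < s + q"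
        using representative_mod_period[OF \<open>q > 0\<close>] .
      then have "dist (t + of_int k * q) s < d" using q by (simp add: dist_real_def)
      then have "dist (x (t + of_int k * q)) (x s) < dist (x t) (x s)" by (rule d(2))
      moreover have "x (t + of_int k * q) = x t" using periodic_int_shift[of x, OF per] .
      ultimately show False by simp
    qed
    then show False using nc unfolding constant_on_def by blast
  qed
  have "x (t + p) = x t" for t
  proof -
    have "\<forall>n. \<exists>q\<in>P. q < p + 1 / real (Suc n)" using approx by simp
    then obtain q where q: "\<And>n. q n \<in> P" "\<And>n. q n < p + 1 / real (Suc n)" by metis
    have "q \<longlonglongrightarrow> p"
    proof (rule tendsto_sandwich[of "\<lambda>_. p" _ _ "\<lambda>n. p + 1 / real (Suc n)"])
      show "(\<lambda>n. p + 1 / real (Suc n)) \<longlonglongrightarrow> p"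
        using tendsto_add[OF tendsto_const LIMSEQ_inverse_real_of_nat, of p] by (simp add: inverse_eq_divide)
      show "\<forall>\<^sub>F n in sequentially. p \<le> q n" using lower[OF q(1)] by (simp add: always_eventually)
      show "\<forall>\<^sub>F n in sequentially. q n \<le> p + 1 / real (Suc n)"
        using less_imp_le[OF q(2)] by (intro always_eventually allI)
    qed simp
    then have "(\<lambda>n. x (t + q n)) \<longlonglongrightarrow> x (t + p)"
      by (intro isCont_tendsto_compose[OF contx] tendsto_intros)
    moreover have "(\<lambda>n. x (t + q n)) = (\<lambda>n. x t)"
    proof
      show "x (t + q n) = x t" for n using q(1)[of n] unfolding P_def has_period_def by blast
    qed
    ultimately show ?thesis using LIMSEQ_unique[OF tendsto_const[of "x t" sequentially]] by metis
  qed
  then have "has_period x p" using \<open>p > 0\<close> unfolding has_period_def by blast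
  moreover have "p \<le> q" if "has_period x q" for q using lower that by (simp add: P_def)
  ultimately show ?thesis using that unfolding has_minimal_period_def by blast
qed

lemma shift_multiple_of_minimal_period:
  assumes min: "has_minimal_period x p" and c: "\<And>t. x (t + c) = x t"
  obtains k :: int where "c = of_int k * p"
proof -
  have "p > 0" and per: "\<And>t. x (t + p) = x t" using min unfolding has_minimal_period_def has_period_def by blast+
  obtain k :: int where k: "0 \<le> c + of_int k * p" "c + of_int k * p < p"
    using representative_mod_period[OF \<open>p > 0\<close>, of 0 c] by auto
  have "x (t + (c + of_int k * p)) = x t" for t
    using periodic_int_shift[of x, OF per, of "t + c" k] c by (simp add: add.assoc)
  then have "has_period x (c + of_int k * p)" if "c + of_int k * p > 0"
    using that unfolding has_period_def by blast
  then have "\<not> c + of_int k * p > 0" using min k(2) unfolding has_minimal_period_def by fastforce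
  then have "c = of_int (-k) * p" using k by simp
  then show ?thesis using that by blast
qed

lemma periodic_attains_max:
  fixes x :: "real \<Rightarrow> real"
  assumes cont: "continuous_on UNIV x" and per: "has_period x p"
  obtains t where "\<forall>s. x s \<le> x t"
proof -
  have "p > 0" and shift: "\<And>t. x (t + p) = x t" using per unfolding has_period_def by blast+
  obtain t where t: "\<forall>s\<in>{0..p}. x s \<le> x t"
    using continuous_attains_sup[of "{0..p}" x] \<open>p > 0\<close> continuous_on_subset[OF cont] by force
  have "x s \<le> x t" for s
  proof -
    obtain k :: int where "0 \<le> s + of_int k * p" "s + of_int k * p < 0 + p"
      using representative_mod_period[OF \<open>p > 0\<close>] .
    then show ?thesis using t[rule_format, of "s + of_int k * p"] periodic_int_shift[of x, OF shift, of s k] by simp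
  qed
  then show ?thesis using that by blast
qed

lemma has_period_minus: "has_period x p \<Longrightarrow> has_period (\<lambda>t. - x t :: real) p"
  by (simp add: has_period_def)

lemma has_period_shift:
  fixes c :: real
  assumes "has_period x p" shows "has_period (\<lambda>t. x (t + c)) p"
proof -
  have "x ((t + c) + p) = x (t + c)" for t using assms unfolding has_period_def by blast
  then have "x (t + p + c) = x (t + c)" for t by (metis add.assoc add.commute)
  then show ?thesis using assms unfolding has_period_def by blast
qed

lemma periodic_bounded:
  fixes x :: "real \<Rightarrow> real"
  assumes cont: "continuous_on UNIV x" and per: "has_period x p"
  obtains R where "\<forall>s. \<bar>x s\<bar> \<le> R"
proof -
  obtain t where t: "\<forall>s. x s \<le> x t" using periodic_attains_max[OF cont per] .
  obtain u where u: "\<forall>s. - x s \<le> - x u"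
    using periodic_attains_max[OF continuous_on_minus[OF cont] has_period_minus[OF per]] .
  have "\<bar>x s\<bar> \<le> \<bar>x t\<bar> + \<bar>x u\<bar>" for s using t[rule_format, of s] u[rule_format, of s] by linarith
  then show ?thesis using that by blast
qed

lemma has_period_pair:
  fixes u\<^sub>1 u\<^sub>2 :: "real \<Rightarrow> real"
  shows "has_period (\<lambda>t. (u\<^sub>1 t, u\<^sub>2 t)) p \<longleftrightarrow> has_period u\<^sub>1 p \<and> has_period u\<^sub>2 p"
  unfolding has_period_def by blast

lemma DERIV_reflect:
  fixes u :: "real \<Rightarrow> real"
  assumes "(u has_real_derivative D) (at (c - t))"
  shows "((\<lambda>t. u (c - t)) has_real_derivative - D) (at t)"
  using DERIV_chain2[where f = u and g = "\<lambda>t. c - t" and x = t, OF assms DERIV_diff[OF DERIV_const DERIV_ident]]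
  by simp

lemma has_period_reflect:
  fixes x :: "real \<Rightarrow> 'a"
  assumes "has_period x p" shows "has_period (\<lambda>t. x (c - t)) p"
proof -
  have "x (c - (t + p)) = x (c - t)" for t
    using assms[unfolded has_period_def, THEN conjunct2, rule_format, of "c - (t + p)"] by simp
  then show ?thesis using assms unfolding has_period_def by blast
qed

lemma has_period_compose:
  "has_period x p \<Longrightarrow> has_period (\<lambda>t. g (x t)) p"
  unfolding has_period_def by metis

lemma has_minimal_period_unique: "has_minimal_period x p \<Longrightarrow> has_minimal_period x q \<Longrightarrow> p = q"
  unfolding has_minimal_period_def by (meson order_antisym)

lemma has_period_shift_iff:
  fixes c :: real
  shows "has_period (\<lambda>t. x (t + c)) p \<longleftrightarrow> has_period x p"
  using has_period_shift[of x p c] has_period_shift[of "\<lambda>t. x (t + c)" p "- c"] by auto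

section \<open>Coincidences of two solutions\<close>

text \<open>This is what comparing two solutions of a function of \<open>X_plus\<close> uses: order in the delayed argument, and a Lipschitz
  bound on bounded sets, as periodic solutions are bounded.\<close>

locale symmetric_feedback =
  fixes f :: "real \<times> real \<Rightarrow> real"
  assumes even1: "f (- u, v) = f (u, v)"
    and odd2: "f (u, - v) = - f (u, v)"
    and mono2: "v < v' \<Longrightarrow> f (u, v) < f (u, v')"
    and cont: "continuous_on UNIV f"
    and lipschitz: "\<exists>L>0. \<forall>u v u' v'. \<bar>u\<bar> \<le> R \<and> \<bar>v\<bar> \<le> R \<and> \<bar>u'\<bar> \<le> R \<and> \<bar>v'\<bar> \<le> R \<longrightarrow>
          \<bar>f (u, v) - f (u', v')\<bar> \<le> L * (\<bar>u - u'\<bar> + \<bar>v - v'\<bar>)"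
begin

lemma zero2 [simp]: "f (u, 0) = 0"
  using odd2[of u 0] by simp

lemma inj2 [simp]: "f (u, v) = f (u, v') \<longleftrightarrow> v = v'"
  using mono2[of v v' u] mono2[of v' v u] by (metis less_irrefl linorder_neqE_linordered_idom)

lemma less2 [simp]: "f (u, v) < f (u, v') \<longleftrightarrow> v < v'"
  using mono2[of v v' u] mono2[of v' v u] inj2[of u v v'] by linarith

lemma sign2 [simp]: "f (u, v) = 0 \<longleftrightarrow> v = 0" "0 < f (u, v) \<longleftrightarrow> 0 < v" "f (u, v) < 0 \<longleftrightarrow> v < 0"
  using inj2[of u v 0] less2[of u 0 v] less2[of u v 0] by (simp_all del: inj2 less2)

definition solution :: "real \<Rightarrow> (real \<Rightarrow> real) \<Rightarrow> bool" where
  "solution r x \<longleftrightarrow> (\<forall>t. (x has_real_derivative f (x t, x (t - r))) (at t))"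

lemma solution_deriv: "solution r x \<Longrightarrow> (x has_real_derivative f (x t, x (t - r))) (at t)"
  by (simp add: solution_def)

lemma solution_cont: "solution r x \<Longrightarrow> isCont x t"
  using solution_deriv DERIV_isCont by blast

lemma solution_continuous_on: "solution r x \<Longrightarrow> continuous_on S x"
  by (simp add: solution_cont continuous_at_imp_continuous_on)

lemma solution_zero: "solution r (\<lambda>t. 0)"
  by (simp add: solution_def)

lemma solution_shift:
  assumes "solution r x" shows "solution r (\<lambda>t. x (t + c))"
  unfolding solution_def
proof
  fix t
  have "((\<lambda>t. x (t + c)) has_real_derivative f (x (t + c), x (t + c - r))) (at t)"
    using solution_deriv[OF assms, of "t + c"] by (simp add: DERIV_shift)
  then show "((\<lambda>t. x (t + c)) has_real_derivative f (x (t + c), x (t - r + c))) (at t)"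
    by (simp add: algebra_simps)
qed

lemma solution_minus:
  assumes "solution r x" shows "solution r (\<lambda>t. - x t)"
  using solution_deriv[OF assms] by (auto simp: solution_def even1 odd2 intro: DERIV_minus)

text \<open>While \<open>x (s - r) > y (s - r)\<close>, the difference \<open>w = x - y\<close> obeys \<open>w' > - L * \<bar>w\<bar>\<close>. Where \<open>w > 0\<close> this makes
  \<open>w * exp (L * t)\<close> increase, so that \<open>w\<close> cannot come back to zero; where \<open>w < 0\<close> it makes
  \<open>w * exp (- L * t)\<close> increase, so that \<open>w\<close> cannot have come from zero; and \<open>w\<close> cannot vanish identically.\<close>

lemma no_ordered_arc:
  assumes x: "solution r x" and y: "solution r y"
    and R: "\<And>t. \<bar>x t\<bar> \<le> R" "\<And>t. \<bar>y t\<bar> \<le> R"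
    and z: "z1 < z2" "x z1 = y z1" "x z2 = y z2"
    and above: "\<And>s. z1 < s \<Longrightarrow> s < z2 \<Longrightarrow> x (s - r) > y (s - r)"
  shows False
proof -
  obtain L where L: "L > 0" "\<And>u v u' v'. \<bar>u\<bar> \<le> R \<Longrightarrow> \<bar>v\<bar> \<le> R \<Longrightarrow> \<bar>u'\<bar> \<le> R \<Longrightarrow> \<bar>v'\<bar> \<le> R \<Longrightarrow>
      \<bar>f (u, v) - f (u', v')\<bar> \<le> L * (\<bar>u - u'\<bar> + \<bar>v - v'\<bar>)"
    using lipschitz[of R] by blast
  define w where "w t = x t - y t" for t
  define w' where "w' t = f (x t, x (t - r)) - f (y t, y (t - r))" for t
  have w': "(w has_real_derivative w' t) (at t)" for t
    unfolding w_def w'_def by (intro derivative_intros solution_deriv x y)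
  have contw: "continuous_on S w" for S
    using w' DERIV_isCont by (meson continuous_at_imp_continuous_on)
  have wz: "w z1 = 0" "w z2 = 0" using z by (simp_all add: w_def)
  have lower: "w' t > - L * \<bar>w t\<bar>" if "z1 < t" "t < z2" for t
  proof -
    have "f (x t, y (t - r)) - f (y t, y (t - r)) \<ge> - L * \<bar>w t\<bar>"
      using L(2)[of "x t" "y (t - r)" "y t" "y (t - r)"] R by (simp add: w_def)
    moreover have "f (x t, x (t - r)) > f (x t, y (t - r))" using above that by simp
    ultimately show ?thesis unfolding w'_def by linarith
  qed
  have incr: "w s * exp (c * s) < w t * exp (c * t)"
    if "z1 \<le> s" "s < t" "t \<le> z2" and sgn: "\<And>\<tau>. s < \<tau> \<Longrightarrow> \<tau> < t \<Longrightarrow> L * \<bar>w \<tau>\<bar> = c * w \<tau>" for s t c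
  proof (rule DERIV_pos_imp_increasing_open[OF \<open>s < t\<close>])
    fix \<tau> assume \<tau>: "s < \<tau>" "\<tau> < t"
    have "((\<lambda>s. w s * exp (c * s)) has_real_derivative (w' \<tau> + c * w \<tau>) * exp (c * \<tau>)) (at \<tau>)"
      by (rule derivative_eq_intros w' refl | simp add: algebra_simps)+
    moreover have "w' \<tau> + c * w \<tau> > 0" using lower[of \<tau>] sgn[OF \<tau>] \<tau> that by simp
    ultimately show "\<exists>y. ((\<lambda>s. w s * exp (c * s)) has_real_derivative y) (at \<tau>) \<and> 0 < y"
      by (intro exI[of _ "(w' \<tau> + c * w \<tau>) * exp (c * \<tau>)"]) simp
  qed (intro continuous_intros contw)
  show False
  proof (cases "\<exists>t. z1 < t \<and> t < z2 \<and> w t \<noteq> 0")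
    case False
    then have "w z1 * exp (0 * z1) < w z2 * exp (0 * z2)" using z by (intro incr) auto
    then show False using wz by simp
  next
    case True
    then obtain t where t: "z1 < t" "t < z2" "w t \<noteq> 0" by blast
    show False
    proof (cases "w t > 0")
      case True
      \<comment> \<open>The first zero after \<open>t\<close>.\<close>
      define Z where "Z = {s \<in> {t..z2}. w s = 0}"
      have "compact Z" unfolding Z_def
        using continuous_closed_preimage_constant[of "{t..z2}" w 0] contw
        by (simp add: compact_eq_bounded_closed bounded_subset[of "{t..z2}"] subset_iff)
      moreover have "z2 \<in> Z" using wz t by (simp add: Z_def)
      ultimately obtain e where e: "e \<in> Z" "\<And>s. s \<in> Z \<Longrightarrow> e \<le> s"
        using compact_attains_inf[of Z] by auto
      have pos: "w s > 0" if s: "t < s" "s < e" for s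
      proof (rule ccontr)
        assume "\<not> w s > 0"
        then obtain s' where "t \<le> s'" "s' \<le> s" "w s' = 0"
          using IVT2'[of w s 0 t] True contw less_imp_le[OF s(1)] by auto
        then show False using e(2)[of s'] s e(1) by (auto simp: Z_def)
      qed
      have "t < e" using e(1) True t by (cases "t = e") (auto simp: Z_def)
      then have "w t * exp (L * t) < w e * exp (L * e)"
        using e(1) t by (intro incr) (auto simp: Z_def abs_of_pos[OF pos])
      moreover have "w e = 0" using e(1) by (simp add: Z_def)
      ultimately show False using True by (simp add: mult_less_0_iff)
    next
      case False
      then have neg: "w t < 0" using t by simp
      \<comment> \<open>The last zero before \<open>t\<close>.\<close>
      define Z where "Z = {s \<in> {z1..t}. w s = 0}"
      have "compact Z" unfolding Z_def
        using continuous_closed_preimage_constant[of "{z1..t}" w 0] contw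
        by (simp add: compact_eq_bounded_closed bounded_subset[of "{z1..t}"] subset_iff)
      moreover have "z1 \<in> Z" using wz t by (simp add: Z_def)
      ultimately obtain e where e: "e \<in> Z" "\<And>s. s \<in> Z \<Longrightarrow> s \<le> e"
        using compact_attains_sup[of Z] by auto
      have pos: "w s < 0" if s: "e < s" "s < t" for s
      proof (rule ccontr)
        assume "\<not> w s < 0"
        then obtain s' where "s \<le> s'" "s' \<le> t" "w s' = 0"
          using IVT2'[of w t 0 s] neg contw less_imp_le[OF s(2)] by auto
        then show False using e(2)[of s'] s e(1) by (auto simp: Z_def)
      qed
      have "e < t" using e(1) neg t by (cases "t = e") (auto simp: Z_def)
      then have "w e * exp (- L * e) < w t * exp (- L * t)"
        using e(1) t by (intro incr) (auto simp: Z_def abs_of_neg[OF pos])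
      moreover have "w e = 0" using e(1) by (simp add: Z_def)
      ultimately show False using neg by (simp add: zero_less_mult_iff)
    qed
  qed
qed

text \<open>Rolle's theorem for a delay equation: the difference of the delayed values plays the part of the derivative.\<close>

lemma ex_delayed_coincidence:
  assumes x: "solution r x" and y: "solution r y"
    and R: "\<And>t. \<bar>x t\<bar> \<le> R" "\<And>t. \<bar>y t\<bar> \<le> R"
    and z: "z1 < z2" "x z1 = y z1" "x z2 = y z2"
  obtains s where "z1 < s" "s < z2" "x (s - r) = y (s - r)"
proof (rule ccontr)
  note s = that
  assume "\<not> thesis"
  then have ne: "x (s - r) - y (s - r) \<noteq> 0" if "z1 < s" "s < z2" for s using s that by auto
  have cont: "continuous_on S (\<lambda>s. x (s - r) - y (s - r))" for S
    by (intro continuous_intros continuous_on_compose2[OF solution_continuous_on[OF x, of UNIV]]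
          continuous_on_compose2[OF solution_continuous_on[OF y, of UNIV]]) auto
  have "connected ((\<lambda>s. x (s - r) - y (s - r)) ` {z1<..<z2})"
    by (intro connected_continuous_image cont) auto
  then have "(\<forall>s\<in>{z1<..<z2}. x (s - r) > y (s - r)) \<or> (\<forall>s\<in>{z1<..<z2}. x (s - r) < y (s - r))"
  proof -
    assume c: "connected ((\<lambda>s. x (s - r) - y (s - r)) ` {z1<..<z2})"
    have "False" if "a \<in> {z1<..<z2}" "b \<in> {z1<..<z2}" "x (a - r) \<le> y (a - r)" "x (b - r) \<ge> y (b - r)" for a b
    proof -
      have "0 \<in> (\<lambda>s. x (s - r) - y (s - r)) ` {z1<..<z2}"
        using connectedD_interval[OF c imageI[OF that(1)] imageI[OF that(2)], of 0] that by simp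
      then show False using ne by auto
    qed
    then show ?thesis by (meson linorder_not_le less_imp_le)
  qed
  then show False
  proof
    assume "\<forall>s\<in>{z1<..<z2}. x (s - r) > y (s - r)"
    then show False using no_ordered_arc[OF x y R z] by auto
  next
    assume "\<forall>s\<in>{z1<..<z2}. x (s - r) < y (s - r)"
    then show False using no_ordered_arc[OF y x R(2,1) z(1) z(2)[symmetric] z(3)[symmetric]] by auto
  qed
qed

text \<open>Infinitely many coincidences in an interval produce infinitely many in the same interval moved back by \<open>r\<close>. As
  \<open>x - y\<close> has a zero in the interval and the Lipschitz bound controls its derivative, the maximum of \<open>\<bar>x - y\<bar>\<close> over an
  interval of length at most \<open>1 / (3 * L)\<close> is at most half of the maximum over the earlier interval. The induction
  iterates this estimate backwards in time, where only the global bound \<open>2 * R\<close> is known.\<close>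

lemma coincidence_interval_small:
  assumes x: "solution r x" and y: "solution r y"
    and R: "\<And>t. \<bar>x t\<bar> \<le> R" "\<And>t. \<bar>y t\<bar> \<le> R"
    and L: "L > 0" "\<And>u v u' v'. \<bar>u\<bar> \<le> R \<Longrightarrow> \<bar>v\<bar> \<le> R \<Longrightarrow> \<bar>u'\<bar> \<le> R \<Longrightarrow> \<bar>v'\<bar> \<le> R \<Longrightarrow>
      \<bar>f (u, v) - f (u', v')\<bar> \<le> L * (\<bar>u - u'\<bar> + \<bar>v - v'\<bar>)"
    and h: "h > 0" "3 * L * h \<le> 1"
  shows "infinite {t\<in>{c..c+h}. x t = y t} \<Longrightarrow> t \<in> {c..c+h} \<Longrightarrow> \<bar>x t - y t\<bar> \<le> 2 * R / 2 ^ k"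
proof (induction k arbitrary: c t)
  case 0
  show ?case using R(1)[of t] R(2)[of t] by simp
next
  case (Suc k)
  have inf: "infinite {t\<in>{c-r..c-r+h}. x t = y t}"
  proof
    assume "finite {t\<in>{c-r..c-r+h}. x t = y t}"
    then have "finite ((\<lambda>t. t + r) ` {t\<in>{c-r..c-r+h}. x t = y t})" by simp
    moreover have "{t\<in>{c..c+h}. x (t - r) = y (t - r)} \<subseteq> (\<lambda>t. t + r) ` {t\<in>{c-r..c-r+h}. x t = y t}"
      by (auto intro!: image_eqI[where x = "_ - r"])
    ultimately have fin: "finite {t\<in>{c..c+h}. x (t - r) = y (t - r)}" by (rule finite_subset[rotated])
    have "\<exists>b\<in>{t\<in>{c..c+h}. x (t - r) = y (t - r)}. a < b \<and> b < a'"
      if "a \<in> {t\<in>{c..c+h}. x t = y t}" "a' \<in> {t\<in>{c..c+h}. x t = y t}" "a < a'" for a a'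
    proof -
      have "x a = y a" "x a' = y a'" using that by auto
      then obtain s where "a < s" "s < a'" "x (s - r) = y (s - r)"
        using ex_delayed_coincidence[OF x y R \<open>a < a'\<close>] by blast
      then show ?thesis using that by (intro bexI[of _ s]) auto
    qed
    then have "finite {t\<in>{c..c+h}. x t = y t}" using card_le_of_interlacing[OF fin] by blast
    then show False using Suc by simp
  qed
  define w where "w t = x t - y t" for t
  define w' where "w' t = f (x t, x (t - r)) - f (y t, y (t - r))" for t
  have w': "(w has_real_derivative w' t) (at t)" for t
    unfolding w_def w'_def by (intro derivative_intros solution_deriv x y)
  have contw: "continuous_on S (\<lambda>t. \<bar>w t\<bar>)" for S
    by (intro continuous_intros continuous_at_imp_continuous_on ballI DERIV_isCont[OF w'])
  obtain m where m: "m \<in> {c..c+h}" "\<And>t. t \<in> {c..c+h} \<Longrightarrow> \<bar>w t\<bar> \<le> \<bar>w m\<bar>"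
    using continuous_attains_sup[of "{c..c+h}" "\<lambda>t. \<bar>w t\<bar>"] contw \<open>h > 0\<close> by auto
  have "{t\<in>{c..c+h}. x t = y t} \<noteq> {}" using Suc(2) by (metis finite.emptyI)
  then obtain z where z: "z \<in> {c..c+h}" "w z = 0" by (auto simp: w_def)
  have "\<bar>w' t\<bar> \<le> L * (\<bar>w m\<bar> + 2 * R / 2 ^ k)" if "t \<in> {c..c+h}" for t
  proof -
    have "\<bar>w' t\<bar> \<le> L * (\<bar>w t\<bar> + \<bar>w (t - r)\<bar>)"
      unfolding w_def w'_def using R by (intro L(2)) auto
    also have "\<bar>w (t - r)\<bar> \<le> 2 * R / 2 ^ k" unfolding w_def using that by (intro Suc.IH[OF inf]) auto
    also have "\<bar>w t\<bar> \<le> \<bar>w m\<bar>" using m(2)[OF that] .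
    finally show ?thesis using L(1) by simp
  qed
  then have "norm (w m - w z) \<le> L * (\<bar>w m\<bar> + 2 * R / 2 ^ k) * norm (m - z)"
    using m z by (intro field_differentiable_bound[of "{c..c+h}" w w' "L * (\<bar>w m\<bar> + 2 * R / 2 ^ k)" m z])
      (auto intro: has_field_derivative_at_within[OF w'])
  also have "\<dots> \<le> L * (\<bar>w m\<bar> + 2 * R / 2 ^ k) * h"
    using m z L(1) R(1)[of 0] by (intro mult_left_mono) auto
  also have "\<dots> \<le> (\<bar>w m\<bar> + 2 * R / 2 ^ k) / 3"
  proof -
    have "0 \<le> \<bar>w m\<bar> + 2 * R / 2 ^ k" using R(1)[of 0] by simp
    then have "(3 * L * h) * (\<bar>w m\<bar> + 2 * R / 2 ^ k) \<le> 1 * (\<bar>w m\<bar> + 2 * R / 2 ^ k)"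
      using h(2) by (rule mult_right_mono[rotated])
    then show ?thesis by (simp add: algebra_simps)
  qed
  finally have "\<bar>w m\<bar> \<le> 2 * R / 2 ^ k / 2" using z by simp
  then show ?case using m(2)[OF Suc(3)] by (simp add: w_def)
qed

text \<open>By the preceding estimate two solutions with infinitely many coincidences in a short interval agree on it; overlapping
  intervals propagate the agreement to all later times.\<close>

lemma coincidence_interval:
  assumes x: "solution r x" and y: "solution r y"
    and R: "\<And>t. \<bar>x t\<bar> \<le> R" "\<And>t. \<bar>y t\<bar> \<le> R"
  obtains h where "h > 0"
    "\<forall>c. infinite {t\<in>{c..c+h}. x t = y t} \<longrightarrow> (\<forall>t\<ge>c. x t = y t)"
proof -
  obtain L where L: "L > 0" "\<And>u v u' v'. \<bar>u\<bar> \<le> R \<Longrightarrow> \<bar>v\<bar> \<le> R \<Longrightarrow> \<bar>u'\<bar> \<le> R \<Longrightarrow> \<bar>v'\<bar> \<le> R \<Longrightarrow>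
      \<bar>f (u, v) - f (u', v')\<bar> \<le> L * (\<bar>u - u'\<bar> + \<bar>v - v'\<bar>)"
    using lipschitz[of R] by blast
  define h where "h = 1 / (3 * L)"
  have h: "h > 0" "3 * L * h \<le> 1" using L(1) by (simp_all add: h_def)
  have eq: "x t = y t" if "infinite {t\<in>{c..c+h}. x t = y t}" "t \<in> {c..c+h}" for c t
  proof -
    have "(\<lambda>k. 2 * R / 2 ^ k) \<longlonglongrightarrow> 0"
      using tendsto_mult_left_zero[OF LIMSEQ_power_zero[of "1/2::real"], of "2 * R"] by (simp add: power_divide)
    moreover have "\<bar>x t - y t\<bar> \<le> 2 * R / 2 ^ k" for k
      using coincidence_interval_small[OF x y R L h that] .
    ultimately have "\<bar>x t - y t\<bar> \<le> 0" by (intro LIMSEQ_le_const) auto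
    then show ?thesis by simp
  qed
  have step: "infinite {t\<in>{c + real n * (h/2)..c + real n * (h/2) + h}. x t = y t}"
    if "infinite {t\<in>{c..c+h}. x t = y t}" for c n
  proof (induction n)
    case (Suc n)
    have "{c + real (Suc n) * (h/2)..c + real n * (h/2) + h}
       \<subseteq> {t\<in>{c + real (Suc n) * (h/2)..c + real (Suc n) * (h/2) + h}. x t = y t}"
    proof
      fix t assume "t \<in> {c + real (Suc n) * (h/2)..c + real n * (h/2) + h}"
      moreover then have "x t = y t" using h by (intro eq[OF Suc.IH]) (auto simp: algebra_simps add_divide_distrib)
      ultimately show "t \<in> {t\<in>{c + real (Suc n) * (h/2)..c + real (Suc n) * (h/2) + h}. x t = y t}"
        using h by (auto simp: algebra_simps add_divide_distrib)
    qed
    moreover have "infinite {c + real (Suc n) * (h/2)..c + real n * (h/2) + h}"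
      using h by (simp add: infinite_Icc algebra_simps)
    ultimately show ?case using finite_subset by blast
  qed (use that in simp)
  show ?thesis
  proof (rule that[OF h(1)], intro allI impI)
    fix c t assume inf: "infinite {t\<in>{c..c+h}. x t = y t}" and "c \<le> t"
    define n where "n = nat \<lfloor>(t - c) / (h/2)\<rfloor>"
    have "real n \<le> (t - c) / (h/2)" "(t - c) / (h/2) < real n + 1"
      using \<open>c \<le> t\<close> h unfolding n_def by (simp_all add: floor_less_iff)
    then have "real n * (h/2) \<le> t - c" "t - c < (real n + 1) * (h/2)"
      using pos_le_divide_eq[of "h/2"] pos_divide_less_eq[of "h/2"] half_gt_zero[OF h(1)] by blast+
    then have "t \<in> {c + real n * (h/2)..c + real n * (h/2) + h}" using h by (auto simp: algebra_simps)
    then show "x t = y t" using eq[OF step[OF inf]] by blast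
  qed
qed

end

context symmetric_feedback begin

text \<open>Suppose that \<open>x - y\<close> has \<open>N\<close> zeros in the period that starts at \<open>t0\<close>. Together with \<open>t0 + p\<close> they bound \<open>N\<close>
  gaps, and each gap contains a zero of the delayed difference in its interior. The delayed difference has only
  \<open>N\<close> zeros in a period, so it cannot also vanish at the end point \<open>t0\<close>. For \<open>N = \<infinity>\<close> the solutions agree
  anyway.\<close>

lemma no_double_coincidence:
  assumes x: "solution r x" "has_period x p" and y: "solution r y" "has_period y p"
    and t0: "x t0 = y t0" "x (t0 - r) = y (t0 - r)"
  shows "x t = y t"
proof -
  have "p > 0" and perx: "\<And>t. x (t + p) = x t" and pery: "\<And>t. y (t + p) = y t"
    using x(2) y(2) unfolding has_period_def by blast+
  obtain R1 where R1: "\<forall>s. \<bar>x s\<bar> \<le> R1" using periodic_bounded[OF solution_continuous_on[OF x(1)] x(2)] .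
  obtain R2 where R2: "\<forall>s. \<bar>y s\<bar> \<le> R2" using periodic_bounded[OF solution_continuous_on[OF y(1)] y(2)] .
  have R: "\<And>t. \<bar>x t\<bar> \<le> max R1 R2" "\<And>t. \<bar>y t\<bar> \<le> max R1 R2"
    using R1 R2 by (simp_all add: le_max_iff_disj)
  obtain h where h: "h > 0" "\<forall>c. infinite {t\<in>{c..c+h}. x t = y t} \<longrightarrow> (\<forall>t\<ge>c. x t = y t)"
    using coincidence_interval[OF x(1) y(1) R] .
  show ?thesis
  proof (cases "\<exists>c. infinite {t\<in>{c..c+h}. x t = y t}")
    case True
    then obtain c where c: "infinite {t\<in>{c..c+h}. x t = y t}" by blast
    obtain k :: int where "c \<le> t + of_int k * p" using representative_mod_period[OF \<open>p > 0\<close>] by blast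
    then have "x (t + of_int k * p) = y (t + of_int k * p)" using h(2) c by blast
    then show ?thesis
      using periodic_int_shift[of x, OF perx, of t k] periodic_int_shift[of y, OF pery, of t k] by simp
  next
    case False
    have fin: "finite {s\<in>{t0..t0+real n * h}. x s = y s}" for n
    proof (induction n)
      case (Suc n)
      have "{s\<in>{t0..t0+real (Suc n) * h}. x s = y s} \<subseteq> {s\<in>{t0..t0+real n * h}. x s = y s} \<union>
          {s\<in>{t0+real n * h..t0+real n * h+h}. x s = y s}" by (auto simp: algebra_simps)
      moreover have "finite {s\<in>{t0+real n * h..t0+real n * h+h}. x s = y s}" using False by blast
      ultimately show ?case using Suc finite_subset finite_UnI by blast
    next
      case 0
      have "{s\<in>{t0..t0+real 0 * h}. x s = y s} \<subseteq> {t0}" by auto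
      then show ?case using finite_subset by blast
    qed
    define w where "w t = x t - y t" for t
    have w: "w (t + p) = w t" for t by (simp add: w_def perx pery)
    define Z where "Z = {s\<in>{t0..<t0+p}. w s = 0}"
    obtain n where "p / h < real n" using reals_Archimedean2 by blast
    then have "p < real n * h" using h(1) by (simp add: pos_divide_less_eq)
    then have "Z \<subseteq> {s\<in>{t0..t0+real n * h}. x s = y s}" by (auto simp: Z_def w_def)
    then have finZ: "finite Z" using fin finite_subset by blast
    define Zr where "Zr = (\<lambda>s. s + r) ` {s\<in>{t0-r..<t0-r+p}. w s = 0}"
    have finZr: "finite Zr" and cardZr: "card Zr \<le> card Z"
      unfolding Zr_def using card_zeros_per_period[of w, OF w \<open>p > 0\<close>, of t0 "t0 - r"] finZ
      by (simp_all add: Z_def card_image)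
    have inZr: "s \<in> Zr" if "t0 \<le> s" "s < t0 + p" "x (s - r) = y (s - r)" for s
      unfolding Zr_def using that by (intro image_eqI[of _ _ "s - r"]) (auto simp: w_def)
    have t0Zr: "t0 \<in> Zr" using inZr t0 \<open>p > 0\<close> by simp
    have "card (insert (t0 + p) Z) \<le> card (Zr - {t0}) + 1"
    proof (rule conjunct2[OF card_le_of_interlacing])
      fix a a' assume a: "a \<in> insert (t0 + p) Z" "a' \<in> insert (t0 + p) Z" "a < a'"
      have "x (t0 + p) = y (t0 + p)" using perx[of t0] pery[of t0] t0(1) by simp
      then have eq: "x s = y s" if "s \<in> insert (t0 + p) Z" for s
        using that by (cases "s = t0 + p") (simp_all add: Z_def w_def)
      obtain s where s: "a < s" "s < a'" "x (s - r) = y (s - r)"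
        using ex_delayed_coincidence[OF x(1) y(1) R a(3) eq[OF a(1)] eq[OF a(2)]] .
      have "t0 \<le> a" "a' \<le> t0 + p" using a \<open>p > 0\<close> by (auto simp: Z_def)
      then have "s \<in> Zr - {t0}" using s inZr[of s] by auto
      then show "\<exists>b\<in>Zr - {t0}. a < b \<and> b < a'" using s by blast
    qed (use finZr in simp)
    moreover have "card (insert (t0 + p) Z) = card Z + 1" using finZ by (simp add: Z_def)
    moreover have "card (Zr - {t0}) + 1 = card Zr" using card_Suc_Diff1[OF finZr t0Zr] by simp
    ultimately show ?thesis using cardZr by linarith
  qed
qed

end

section \<open>Symmetry under half of the minimal period\<close>

text \<open>A sign change of \<open>x t - y (t - (a - b))\<close> at \<open>t = a\<close> survives a small increase of the shift \<open>a - b\<close>. Therefore a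
  coincidence that maximises \<open>a - b\<close> must be tangential, and for solutions of the delay equation tangential
  coincidences are double coincidences.\<close>

lemma transversal_coincidence_persists:
  fixes x y :: "real \<Rightarrow> real"
  assumes x: "continuous_on UNIV x" "(x has_real_derivative X) (at a)"
    and y: "continuous_on UNIV y" "(y has_real_derivative Y) (at b)"
    and "x a = y b" "X \<noteq> Y" "\<epsilon> > 0"
  obtains a' b' where "\<bar>a' - a\<bar> < \<epsilon>" "\<bar>b' - b\<bar> < \<epsilon>" "x a' = y b'" "a - b < a' - b'"
proof -
  define \<phi> where "\<phi> \<delta> t = x t - y (t - (a - b) - \<delta>)" for \<delta> t
  have "((\<lambda>t. y (t + (b - a))) has_real_derivative Y) (at a)"
    using y(2) DERIV_shift[of y Y a "b - a"] by simp
  then have D: "(\<phi> 0 has_real_derivative X - Y) (at a)"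
    unfolding \<phi>_def using x(2) by (auto intro!: derivative_eq_intros simp: algebra_simps)
  have z: "\<phi> 0 a = 0" using \<open>x a = y b\<close> by (simp add: \<phi>_def)
  obtain \<eta> where \<eta>: "0 < \<eta>" "\<eta> < \<epsilon> / 2" "\<phi> 0 (a - \<eta>) * \<phi> 0 (a + \<eta>) < 0"
  proof (cases "X - Y > 0")
    case True
    obtain d1 where d1: "d1 > 0" "\<And>h. 0 < h \<Longrightarrow> h < d1 \<Longrightarrow> \<phi> 0 a < \<phi> 0 (a + h)"
      using DERIV_pos_inc_right[OF D True] by auto
    obtain d2 where d2: "d2 > 0" "\<And>h. 0 < h \<Longrightarrow> h < d2 \<Longrightarrow> \<phi> 0 (a - h) < \<phi> 0 a"
      using DERIV_pos_inc_left[OF D True] by auto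
    show ?thesis
      using that[of "min (min d1 d2) (\<epsilon>/2) / 2"] d1 d2 z \<open>\<epsilon> > 0\<close> by (auto simp: mult_less_0_iff)
  next
    case False
    then have neg: "X - Y < 0" using \<open>X \<noteq> Y\<close> by simp
    obtain d1 where d1: "d1 > 0" "\<And>h. 0 < h \<Longrightarrow> h < d1 \<Longrightarrow> \<phi> 0 a > \<phi> 0 (a + h)"
      using DERIV_neg_dec_right[OF D neg] by auto
    obtain d2 where d2: "d2 > 0" "\<And>h. 0 < h \<Longrightarrow> h < d2 \<Longrightarrow> \<phi> 0 (a - h) > \<phi> 0 a"
      using DERIV_neg_dec_left[OF D neg] by auto
    show ?thesis
      using that[of "min (min d1 d2) (\<epsilon>/2) / 2"] d1 d2 z \<open>\<epsilon> > 0\<close> by (auto simp: mult_less_0_iff)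
  qed
  have "((\<lambda>\<delta>. \<phi> \<delta> (a - \<eta>) * \<phi> \<delta> (a + \<eta>)) \<longlongrightarrow> \<phi> 0 (a - \<eta>) * \<phi> 0 (a + \<eta>)) (at_right 0)"
  proof -
    have "continuous_on UNIV (\<lambda>\<delta>. \<phi> \<delta> (a - \<eta>) * \<phi> \<delta> (a + \<eta>))"
      unfolding \<phi>_def by (intro continuous_intros continuous_on_compose2[OF y(1)]) auto
    then have "isCont (\<lambda>\<delta>. \<phi> \<delta> (a - \<eta>) * \<phi> \<delta> (a + \<eta>)) 0"
      by (simp add: continuous_on_eq_continuous_at)
    then show ?thesis unfolding isCont_def filterlim_at_split by blast
  qed
  then have "\<forall>\<^sub>F \<delta> in at_right 0. \<phi> \<delta> (a - \<eta>) * \<phi> \<delta> (a + \<eta>) < 0"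
    using \<eta>(3) by (rule order_tendstoD(2))
  moreover have "\<forall>\<^sub>F \<delta> in at_right 0. \<delta> \<in> {0<..<\<epsilon>/2}"
    using \<open>\<epsilon> > 0\<close> by (intro eventually_at_right_real) simp
  ultimately have "\<forall>\<^sub>F \<delta> in at_right 0. \<delta> \<in> {0<..<\<epsilon>/2} \<and> \<phi> \<delta> (a - \<eta>) * \<phi> \<delta> (a + \<eta>) < 0"
    by eventually_elim simp
  then have "\<exists>\<delta>. \<delta> \<in> {0<..<\<epsilon>/2} \<and> \<phi> \<delta> (a - \<eta>) * \<phi> \<delta> (a + \<eta>) < 0"
    by (rule eventually_happens'[OF trivial_limit_at_right_real])
  then obtain \<delta> where \<delta>: "0 < \<delta>" "\<delta> < \<epsilon>/2" "\<phi> \<delta> (a - \<eta>) * \<phi> \<delta> (a + \<eta>) < 0"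
    unfolding greaterThanLessThan_iff by blast
  have cont: "continuous_on {a-\<eta>..a+\<eta>} (\<phi> \<delta>)"
    unfolding \<phi>_def by (intro continuous_intros continuous_on_subset[OF x(1)] continuous_on_compose2[OF y(1)]) auto
  have "\<exists>t\<ge>a-\<eta>. t \<le> a+\<eta> \<and> \<phi> \<delta> t = 0"
  proof (cases "\<phi> \<delta> (a - \<eta>) < 0")
    case True
    then show ?thesis using IVT'[of "\<phi> \<delta>" "a-\<eta>" 0 "a+\<eta>"] \<delta> \<eta> cont by (auto simp: mult_less_0_iff)
  next
    case False
    then show ?thesis using IVT2'[of "\<phi> \<delta>" "a+\<eta>" 0 "a-\<eta>"] \<delta> \<eta> cont by (auto simp: mult_less_0_iff)
  qed
  then obtain t where t: "a - \<eta> \<le> t" "t \<le> a + \<eta>" "\<phi> \<delta> t = 0" by blast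
  show ?thesis
    using that[of t "t - (a - b) - \<delta>"] t \<eta> \<delta> by (auto simp: \<phi>_def)
qed

context symmetric_feedback begin

lemma delayed_zero_at_max:
  assumes x: "solution r x" and max: "\<And>t. x t \<le> x t1"
  shows "x (t1 - r) = 0"
  using DERIV_local_max[OF solution_deriv[OF x, of t1] zero_less_one] max by simp

text \<open>If \<open>x\<close> and \<open>- x\<close> attain the same maximum, then both maxima give the same point of the plane. Otherwise the points
  \<open>(a, b)\<close> of the square over one period with \<open>x a = - x b\<close> stay away from its boundary, because nothing balances the
  larger maximum \<open>x t1\<close>. A point among them that maximises \<open>a - b\<close> is a tangential coincidence of \<open>x\<close> and
  \<open>- x\<close>.\<close>

lemma ex_antiperiod_aux:
  assumes x: "solution r x" "has_period x p"
    and t1: "\<And>t. x t \<le> x t1" and t2: "\<And>t. x t2 \<le> x t" and le: "- x t2 \<le> x t1"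
  shows "\<exists>s. \<forall>t. x (t - s) = - x t"
proof -
  have "p > 0" and per: "\<And>t. x (t + p) = x t" using x(2) unfolding has_period_def by blast+
  note contx = solution_continuous_on[OF x(1)]
  have double: "\<exists>s. \<forall>t. x (t - s) = - x t" if "x a = - x b" "x (a - r) = - x (b - r)" for a b
  proof -
    have eq: "a + (b - a) = b" "a - r + (b - a) = b - r" by simp_all
    have "x (t - (a - b)) = - x t" for t
      using no_double_coincidence[OF x solution_minus[OF solution_shift[OF x(1), of "b - a"]]
        has_period_minus[OF has_period_shift[OF x(2), of "b - a"]], of a t, unfolded eq, OF that]
        arg_cong[of "t + (b - a)" "t - (a - b)" x] by linarith
    then show ?thesis by blast
  qed
  have z1: "x (t1 - r) = 0" using delayed_zero_at_max[OF x(1) t1] .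
  have z2: "x (t2 - r) = 0" using delayed_zero_at_max[OF solution_minus[OF x(1)], of t2] t2 by simp
  show ?thesis
  proof (cases "x t1 = - x t2")
    case True
    then show ?thesis using double[of t1 t2] z1 z2 by simp
  next
    case False
    then have pos: "x t1 + x b > 0" for b using le t2[of b] by simp
    define I where "I = {t1..t1+p}"
    define K where "K = (I \<times> I) \<inter> {z. x (fst z) + x (snd z) = 0}"
    have "compact K" unfolding K_def I_def
      by (intro compact_Int_closed compact_Times closed_Collect_eq continuous_intros
          continuous_on_compose2[OF contx]) auto
    moreover have "K \<noteq> {}"
    proof -
      obtain k :: int where k: "t1 \<le> (t1 - r) + of_int k * p" "(t1 - r) + of_int k * p < t1 + p"
        using representative_mod_period[OF \<open>p > 0\<close>] .
      have "x ((t1 - r) + of_int k * p) = 0" using periodic_int_shift[of x, OF per] z1 by simp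
      then have "((t1 - r) + of_int k * p, (t1 - r) + of_int k * p) \<in> K" using k by (simp add: K_def I_def)
      then show ?thesis by blast
    qed
    moreover have "continuous_on K (\<lambda>z. fst z - snd z)" by (intro continuous_intros)
    ultimately obtain z where z: "z \<in> K" "\<And>z'. z' \<in> K \<Longrightarrow> fst z' - snd z' \<le> fst z - snd z"
      using continuous_attains_sup[of K "\<lambda>z. fst z - snd z"] by auto
    obtain a b where ab: "z = (a, b)" by fastforce
    have xab: "x a = - x b" using z(1) by (simp add: ab K_def)
    have "a \<noteq> t1" "a \<noteq> t1 + p" "b \<noteq> t1" "b \<noteq> t1 + p"
      using pos[of a] pos[of b] xab per[of t1] by auto
    then have inner: "t1 < a" "a < t1 + p" "t1 < b" "b < t1 + p" using z(1) by (auto simp: ab K_def I_def)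
    show ?thesis
    proof (cases "f (x a, x (a - r)) = - f (x b, x (b - r))")
      case True
      moreover have "- f (x b, x (b - r)) = f (x a, - x (b - r))" using xab odd2 even1 by simp
      ultimately have "f (x a, x (a - r)) = f (x a, - x (b - r))" by (rule trans)
      then have "x (a - r) = - x (b - r)" by simp
      then show ?thesis using double xab by blast
    next
      case False
      define \<epsilon> where "\<epsilon> = min (min (a - t1) (t1 + p - a)) (min (b - t1) (t1 + p - b))"
      have "\<epsilon> > 0" using inner by (simp add: \<epsilon>_def)
      obtain a' b' where a': "\<bar>a' - a\<bar> < \<epsilon>" "\<bar>b' - b\<bar> < \<epsilon>" "x a' = - x b'" "a - b < a' - b'"
        using transversal_coincidence_persists[OF contx solution_deriv[OF x(1), of a]
            solution_continuous_on[OF solution_minus[OF x(1)]] DERIV_minus[OF solution_deriv[OF x(1), of b]] xab False \<open>\<epsilon> > 0\<close>] .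
      have "(a', b') \<in> K" using a' by (auto simp: K_def I_def \<epsilon>_def)
      then show ?thesis using z(2)[of "(a', b')"] a'(4) by (simp add: ab)
    qed
  qed
qed

lemma ex_antiperiod:
  assumes x: "solution r x" "has_period x p"
  obtains s where "\<forall>t. x (t - s) = - x t"
proof -
  note contx = solution_continuous_on[OF x(1)]
  obtain t1 where t1: "\<forall>s. x s \<le> x t1" using periodic_attains_max[OF contx x(2)] .
  obtain t2 where t2: "\<forall>s. - x s \<le> - x t2"
    using periodic_attains_max[OF continuous_on_minus[OF contx] has_period_minus[OF x(2)]] .
  have "\<exists>s. \<forall>t. x (t - s) = - x t"
  proof (cases "- x t2 \<le> x t1")
    case True
    show ?thesis
      by (rule ex_antiperiod_aux[OF x t1[rule_format] _ True]) (rule t2[rule_format, unfolded neg_le_iff_le])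
  next
    case False
    have "\<exists>s. \<forall>t. - x (t - s) = - (- x t)"
    proof (rule ex_antiperiod_aux[OF solution_minus[OF x(1)] has_period_minus[OF x(2)] t2[rule_format]])
      show "- x t1 \<le> - x t" for t using t1 by simp
    qed (use False in simp)
    then show ?thesis unfolding neg_equal_iff_equal .
  qed
  then show ?thesis using that by blast
qed

end

section \<open>The shape of one period\<close>

context symmetric_feedback begin

abbreviation slope :: "real \<Rightarrow> (real \<Rightarrow> real) \<Rightarrow> real \<Rightarrow> real" where
  "slope r x t \<equiv> f (x t, x (t - r))"

lemma slope_continuous_on:
  assumes x: "solution r x" shows "continuous_on S (slope r x)"
  by (intro continuous_on_compose2[OF cont] continuous_intros solution_continuous_on[OF x]
      continuous_on_compose2[OF solution_continuous_on[OF x, of UNIV]]) auto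

text \<open>The zero function is a solution, and it can be met only by itself.\<close>

lemma no_double_zero:
  assumes x: "solution r x" "has_period x p" and t0: "x t0 = 0" "x (t0 - r) = 0"
  shows "x constant_on UNIV"
proof -
  have "has_period (\<lambda>t::real. 0::real) p" using x(2) by (simp add: has_period_def)
  then have "x t = 0" for t using no_double_coincidence[OF x solution_zero] t0 by blast
  then show ?thesis unfolding constant_on_def by blast
qed

lemma double_coincidence_shift:
  assumes x: "solution r x" "has_minimal_period x p" and ab: "x a = x b" "x (a - r) = x (b - r)"
  obtains k :: int where "a - b = of_int k * p"
proof -
  have per: "has_period x p" using x(2) by (simp add: has_minimal_period_def)
  have eq: "b + (a - b) = a" "b - r + (a - b) = a - r" by simp_all
  have "x (t + (a - b)) = x t" for t
    using no_double_coincidence[OF solution_shift[OF x(1), of "a - b"] has_period_shift[OF per, of "a - b"]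
        x(1) per, of b t, unfolded eq, OF ab] .
  then show ?thesis by (rule shift_multiple_of_minimal_period[OF x(2)]) (rule that)
qed

text \<open>By \<open>no_double_zero\<close> critical points are nondegenerate; the two alternatives are a strict local maximum and a strict
  local minimum of \<open>x\<close>.\<close>

lemma critical_sign_change:
  assumes x: "solution r x" "has_period x p" and nc: "\<not> x constant_on UNIV" and c: "x (c - r) = 0"
  shows "(\<exists>\<delta>>0. \<forall>s. 0 < s \<and> s < \<delta> \<longrightarrow> x (c - s - r) > 0 \<and> x (c + s - r) < 0) \<or>
         (\<exists>\<delta>>0. \<forall>s. 0 < s \<and> s < \<delta> \<longrightarrow> x (c - s - r) < 0 \<and> x (c + s - r) > 0)"
proof -
  define D where "D = slope r x (c - r)"
  have D: "(x has_real_derivative D) (at (c - r))" unfolding D_def by (rule solution_deriv[OF x(1)])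
  have "x (c - r - r) \<noteq> 0" using no_double_zero[OF x c] nc by blast
  then have "D < 0 \<or> D > 0" unfolding D_def by (metis sign2(1) linorder_neqE_linordered_idom)
  then show ?thesis
  proof
    assume neg: "D < 0"
    obtain d1 where d1: "d1 > 0" "\<forall>h>0. h < d1 \<longrightarrow> x (c - r) > x (c - r + h)"
      using DERIV_neg_dec_right[OF D neg] by blast
    obtain d2 where d2: "d2 > 0" "\<forall>h>0. h < d2 \<longrightarrow> x (c - r - h) > x (c - r)"
      using DERIV_neg_dec_left[OF D neg] by blast
    have "x (c - s - r) > 0 \<and> x (c + s - r) < 0" if "0 < s" "s < min d1 d2" for s
      using d1(2)[rule_format, of s] d2(2)[rule_format, of s] that c
        arg_cong[of "c - s - r" "c - r - s" x] arg_cong[of "c + s - r" "c - r + s" x] by linarith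
    then show ?thesis using d1(1) d2(1) by (intro disjI1 exI[of _ "min d1 d2"]) auto
  next
    assume pos: "D > 0"
    obtain d1 where d1: "d1 > 0" "\<forall>h>0. h < d1 \<longrightarrow> x (c - r) < x (c - r + h)"
      using DERIV_pos_inc_right[OF D pos] by blast
    obtain d2 where d2: "d2 > 0" "\<forall>h>0. h < d2 \<longrightarrow> x (c - r - h) < x (c - r)"
      using DERIV_pos_inc_left[OF D pos] by blast
    have "x (c - s - r) < 0 \<and> x (c + s - r) > 0" if "0 < s" "s < min d1 d2" for s
      using d1(2)[rule_format, of s] d2(2)[rule_format, of s] that c
        arg_cong[of "c - s - r" "c - r - s" x] arg_cong[of "c + s - r" "c - r + s" x] by linarith
    then show ?thesis using d1(1) d2(1) by (intro disjI2 exI[of _ "min d1 d2"]) auto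
  qed
qed

lemma solution_increasing:
  assumes x: "solution r x" and "s < t" and pos: "\<And>\<tau>. s < \<tau> \<Longrightarrow> \<tau> < t \<Longrightarrow> x (\<tau> - r) > 0"
  shows "x s < x t"
proof (rule DERIV_pos_imp_increasing_open[OF \<open>s < t\<close>])
  fix \<tau> assume "s < \<tau>" "\<tau> < t"
  then show "\<exists>y. (x has_real_derivative y) (at \<tau>) \<and> 0 < y"
    using solution_deriv[OF x, of \<tau>] pos by (intro exI[of _ "slope r x \<tau>"]) simp
qed (rule solution_continuous_on[OF x])

lemma solution_decreasing:
  assumes x: "solution r x" and "s < t" and neg: "\<And>\<tau>. s < \<tau> \<Longrightarrow> \<tau> < t \<Longrightarrow> x (\<tau> - r) < 0"
  shows "x t < x s"
  using solution_increasing[OF solution_minus[OF x] \<open>s < t\<close>] neg by simp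

lemma sign_change_at_max:
  assumes x: "solution r x" "has_period x p" and nc: "\<not> x constant_on UNIV" and max: "\<forall>t. x t \<le> x t1"
  obtains \<delta> where "\<delta> > 0" "\<forall>s. 0 < s \<and> s < \<delta> \<longrightarrow> x (t1 - s - r) > 0 \<and> x (t1 + s - r) < 0"
proof -
  have z: "x (t1 - r) = 0" using delayed_zero_at_max[OF x(1)] max by blast
  have False if "\<delta> > 0" "\<forall>s. 0 < s \<and> s < \<delta> \<longrightarrow> x (t1 - s - r) < 0 \<and> x (t1 + s - r) > 0" for \<delta>
  proof -
    have "x t1 < x (t1 + \<delta> / 2)"
    proof (rule solution_increasing[OF x(1)])
      fix \<tau> assume "t1 < \<tau>" "\<tau> < t1 + \<delta> / 2"
      then show "x (\<tau> - r) > 0" using that(2)[rule_format, of "\<tau> - t1"] \<open>\<delta> > 0\<close> by simp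
    qed (use that in simp)
    then show False using max by (meson not_le)
  qed
  then show ?thesis using critical_sign_change[OF x nc z] that by blast
qed

text \<open>If this fails, consider
  the pairs \<open>(a, b)\<close> of times in one period with \<open>x a = x b\<close> whose slopes are in the wrong order, and maximise \<open>a - b\<close>
  among them. At the maximiser the slopes differ, as otherwise there would be a double coincidence of \<open>x\<close> with a proper shift of
  itself; so it can be moved to increase \<open>a - b\<close>.\<close>

lemma slope_order:
  assumes x: "solution r x" "has_minimal_period x p" and nc: "\<not> x constant_on UNIV"
    and max: "\<forall>t. x t \<le> x t1"
    and ab: "t1 < b" "b < a" "a < t1 + p" "x a = x b"
  shows "slope r x b < slope r x a"
proof (rule ccontr)
  assume le: "\<not> slope r x b < slope r x a"
  have per: "has_period x p" using x(2) by (simp add: has_minimal_period_def)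
  then have "p > 0" and shift: "\<And>t. x (t + p) = x t" unfolding has_period_def by blast+
  note contx = solution_continuous_on[OF x(1)] and conts = slope_continuous_on[OF x(1)]
  obtain \<delta> where \<delta>: "\<delta> > 0" "\<forall>s. 0 < s \<and> s < \<delta> \<longrightarrow> x (t1 - s - r) > 0 \<and> x (t1 + s - r) < 0"
    by (rule sign_change_at_max[OF x(1) per nc max])
  have z1: "x (t1 - r) = 0" using delayed_zero_at_max[OF x(1)] max by blast
  \<comment> \<open>The maximum is attained only once per period, so coincidences do not reach the sides of the triangle.\<close>
  have max_unique: "c = t1 \<or> c = t1 + p" if c: "c \<in> {t1..t1+p}" "x c = x t1" for c
  proof -
    have "x (c - r) = 0" using delayed_zero_at_max[OF x(1), of c] max c(2) by simp
    then obtain k :: int where "c - t1 = of_int k * p"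
      using double_coincidence_shift[OF x c(2)] z1 by metis
    then have "0 \<le> of_int k * p" "of_int k * p \<le> 1 * p" using c by auto
    then have "0 \<le> k" "k \<le> 1" using \<open>p > 0\<close> by (simp_all add: zero_le_mult_iff)
    then have "k = 0 \<or> k = 1" by linarith
    then show ?thesis using \<open>c - t1 = of_int k * p\<close> by auto
  qed
  define I where "I = {t1..t1+p}"
  \<comment> \<open>The last condition cuts the corner \<open>(t1 + p, t1)\<close> off. Close to it \<open>a\<close> lies before a maximum and \<open>b\<close> after one, so
    there the slopes are in the right order and no other point is lost.\<close>
  define K where "K = (I \<times> I) \<inter> {z. snd z \<le> fst z \<and> x (fst z) = x (snd z) \<and>
     slope r x (fst z) \<le> slope r x (snd z) \<and> (fst z \<le> t1 + p - \<delta> \<or> t1 + \<delta> \<le> snd z)}"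
  \<comment> \<open>Off the side \<open>b = t1\<close> the cut removes nothing.\<close>
  have inK: "(a, b) \<in> K" if "a \<in> I" "b \<in> I" "b \<le> a" "x a = x b" "slope r x a \<le> slope r x b" "b \<noteq> t1" for a b
  proof (rule ccontr)
    assume "(a, b) \<notin> K"
    then have corner: "a > t1 + p - \<delta>" "b < t1 + \<delta>" using that by (auto simp: K_def)
    then have "x (b - r) < 0" using \<delta>(2)[rule_format, of "b - t1"] that by (simp add: I_def)
    then have "slope r x a < 0" using that(5) sign2(3) by (meson le_less_trans)
    then have neg: "x (a - r) < 0" by simp
    show False
    proof (cases "a = t1 + p")
      case True
      then show False using neg z1 shift[of "t1 - r"] by (simp add: algebra_simps)
    next
      case False
      then have "x (a - r - p) > 0"
        using \<delta>(2)[rule_format, of "t1 + p - a"] corner that(1) by (simp add: I_def algebra_simps)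
      then show False using neg shift[of "a - r - p"] by simp
    qed
  qed
  have "compact K" unfolding K_def I_def
    by (intro compact_Int_closed compact_Times closed_Collect_conj closed_Collect_disj closed_Collect_eq
        closed_Collect_le continuous_intros continuous_on_compose2[OF contx] continuous_on_compose2[OF conts]) auto
  moreover have "(a, b) \<in> K" using ab leI[OF le] by (intro inK) (auto simp: I_def simp del: less2)
  moreover then have "K \<noteq> {}" by blast
  moreover have "continuous_on K (\<lambda>z. fst z - snd z)" by (intro continuous_intros)
  ultimately obtain z where z: "z \<in> K" "\<And>z'. z' \<in> K \<Longrightarrow> fst z' - snd z' \<le> fst z - snd z"
    using continuous_attains_sup[of K "\<lambda>z. fst z - snd z"] by auto
  obtain a' b' where z_eq: "z = (a', b')" by fastforce
  have "a - b \<le> a' - b'" using z(2)[OF \<open>(a, b) \<in> K\<close>] by (simp add: z_eq)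
  then have "b' < a'" using ab by simp
  have memK: "a' \<in> I" "b' \<in> I" "x a' = x b'" "slope r x a' \<le> slope r x b'" "a' \<le> t1 + p - \<delta> \<or> t1 + \<delta> \<le> b'"
    using z(1) unfolding z_eq K_def Int_iff mem_Collect_eq mem_Sigma_iff fst_conv snd_conv by blast+
  have "a' \<noteq> t1" using \<open>b' < a'\<close> memK by (auto simp: I_def)
  have "b' \<noteq> t1 + p" using \<open>b' < a'\<close> memK by (auto simp: I_def)
  have "a' \<noteq> t1 + p"
  proof
    assume a': "a' = t1 + p"
    then have "x b' = x t1" using memK(3) shift[of t1] by simp
    then have "b' = t1" using max_unique[of b'] memK(2) \<open>b' \<noteq> t1 + p\<close> by (simp add: I_def)
    then show False using memK(5) a' \<delta>(1) by simp
  qed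
  have "b' \<noteq> t1"
  proof
    assume "b' = t1"
    then show False using max_unique[of a'] memK \<open>a' \<noteq> t1 + p\<close> \<open>a' \<noteq> t1\<close> by (simp add: I_def)
  qed
  have inner: "t1 < b'" "a' < t1 + p" using memK \<open>a' \<noteq> t1 + p\<close> \<open>b' \<noteq> t1\<close> by (auto simp: I_def)
  have "slope r x a' \<noteq> slope r x b'"
  proof
    assume "slope r x a' = slope r x b'"
    then have "x (a' - r) = x (b' - r)" using memK(3) by simp
    then obtain k :: int where "a' - b' = of_int k * p" using double_coincidence_shift[OF x memK(3)] by metis
    then have "0 * p < of_int k * p" "of_int k * p < 1 * p" using inner \<open>b' < a'\<close> by linarith+
    then have "0 < real_of_int k" "real_of_int k < 1"
      unfolding mult_less_cancel_right_pos[OF \<open>p > 0\<close>] by blast+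
    then show False by simp
  qed
  then have less: "slope r x a' < slope r x b'" using memK(4) by simp
  define g where "g = (slope r x b' - slope r x a') / 2"
  have "g > 0" using less by (simp add: g_def)
  obtain e1 where e1: "e1 > 0" "\<forall>t. dist t a' < e1 \<longrightarrow> dist (slope r x t) (slope r x a') < g"
    using conts[of UNIV] \<open>g > 0\<close> unfolding continuous_on_iff by (metis UNIV_I)
  obtain e2 where e2: "e2 > 0" "\<forall>t. dist t b' < e2 \<longrightarrow> dist (slope r x t) (slope r x b') < g"
    using conts[of UNIV] \<open>g > 0\<close> unfolding continuous_on_iff by (metis UNIV_I)
  define \<epsilon> where "\<epsilon> = min (min e1 e2) (min (b' - t1) (t1 + p - a'))"
  have "\<epsilon> > 0" using e1 e2 inner by (simp add: \<epsilon>_def)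
  obtain a'' b'' where a'': "\<bar>a'' - a'\<bar> < \<epsilon>" "\<bar>b'' - b'\<bar> < \<epsilon>" "x a'' = x b''" "a' - b' < a'' - b''"
    using transversal_coincidence_persists[OF contx solution_deriv[OF x(1)] contx solution_deriv[OF x(1)]
        memK(3) \<open>slope r x a' \<noteq> slope r x b'\<close> \<open>\<epsilon> > 0\<close>] .
  have "dist (slope r x a'') (slope r x a') < g" "dist (slope r x b'') (slope r x b') < g"
    using e1(2) e2(2) a'' by (auto simp: \<epsilon>_def dist_real_def)
  then have "slope r x a'' - slope r x a' < g" "- (slope r x b'' - slope r x b') < g"
    unfolding dist_real_def abs_less_iff by blast+
  moreover have "2 * g = slope r x b' - slope r x a'" by (simp add: g_def)
  ultimately have "slope r x a'' \<le> slope r x b''" by linarith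
  moreover have "b'' > t1" "a'' < t1 + p" "b'' < a''" using a'' \<open>b' < a'\<close> by (auto simp: \<epsilon>_def)
  ultimately have "(a'', b'') \<in> K" using a''(3) by (intro inK) (auto simp: I_def)
  then show False using z(2)[of "(a'', b'')"] a''(4) by (simp add: z_eq)
qed

text \<open>A level slightly below a local maximum is crossed upwards first and downwards later, against \<open>slope_order\<close>.\<close>

lemma no_second_local_max:
  assumes x: "solution r x" "has_minimal_period x p" and nc: "\<not> x constant_on UNIV"
    and max: "\<forall>t. x t \<le> x t1" and c: "t1 < c" "c < t1 + p"
    and \<delta>: "\<delta> > 0" "\<forall>s. 0 < s \<and> s < \<delta> \<longrightarrow> x (c - s - r) > 0 \<and> x (c + s - r) < 0"
  shows False
proof -
  note contx = solution_continuous_on[OF x(1)]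
  define \<eta> where "\<eta> = min \<delta> (min (c - t1) (t1 + p - c)) / 2"
  have \<eta>: "0 < \<eta>" "\<eta> < \<delta>" "t1 < c - \<eta>" "c + \<eta> < t1 + p"
    using \<delta>(1) c unfolding \<eta>_def by (auto simp: min_def field_simps)
  have pos: "x (t - r) > 0" if "c - \<eta> \<le> t" "t < c" for t
    using \<delta>(2)[rule_format, of "c - t"] that \<eta> by simp
  have neg: "x (t - r) < 0" if "c < t" "t \<le> c + \<eta>" for t
    using \<delta>(2)[rule_format, of "t - c"] that \<eta> by simp
  have l: "x (c - \<eta>) < x c" using \<eta> pos by (intro solution_increasing[OF x(1)]) auto
  have r: "x (c + \<eta>) < x c" using \<eta> neg by (intro solution_decreasing[OF x(1)]) auto
  define v where "v = max (x (c - \<eta>)) (x (c + \<eta>))"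
  have "v < x c" using l r by (simp add: v_def)
  obtain b where b: "c - \<eta> \<le> b" "b \<le> c" "x b = v"
    using IVT'[of x "c - \<eta>" v c] contx \<eta>(1) l \<open>v < x c\<close> by (auto simp: v_def)
  obtain a where a: "c \<le> a" "a \<le> c + \<eta>" "x a = v"
    using IVT2'[of x "c + \<eta>" v c] contx \<eta>(1) r \<open>v < x c\<close> by (auto simp: v_def)
  have "b < c" "c < a" using a b \<open>v < x c\<close> by (auto simp: less_le)
  then have "slope r x b > 0" "slope r x a < 0" using pos[of b] neg[of a] a b by auto
  moreover have "slope r x b < slope r x a"
    using \<eta> a b \<open>b < c\<close> \<open>c < a\<close> by (intro slope_order[OF x nc max]) auto
  ultimately show False by linarith
qed

text \<open>Twice the antiperiod found before is a multiple of the minimal period, and an odd one because \<open>x\<close> is not its own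
  negative.\<close>

lemma antiperiod_half_period:
  assumes x: "solution r x" "has_minimal_period x p" and nc: "\<not> x constant_on UNIV"
  shows "x (t + p / 2) = - x t"
proof -
  have per: "has_period x p" using x(2) by (simp add: has_minimal_period_def)
  then have "p > 0" and shift: "\<And>t. x (t + p) = x t" unfolding has_period_def by blast+
  obtain s where s: "\<forall>t. x (t - s) = - x t" by (rule ex_antiperiod[OF x(1) per])
  have "x (t + - (2 * s)) = x t" for t
    using s[rule_format, of t] s[rule_format, of "t - s"] arg_cong[of "t - s - s" "t + - (2 * s)" x] by linarith
  then obtain k :: int where k: "- (2 * s) = of_int k * p" by (rule shift_multiple_of_minimal_period[OF x(2)])
  have "odd k"
  proof
    assume "even k"
    then obtain j where "k = 2 * j" by blast
    then have js: "- s = of_int j * p" using k by simp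
    have "x t = 0" for t
      using periodic_int_shift[of x, OF shift, of t j] s[rule_format, of t] arg_cong[of "t + of_int j * p" "t - s" x] js
      by linarith
    then show False using nc unfolding constant_on_def by blast
  qed
  then obtain j where "k = 2 * j + 1" by (metis oddE)
  then have "t - s = t + p / 2 + of_int j * p" using k by (simp add: field_simps)
  then have "x (t - s) = x (t + p / 2 + of_int j * p)" by (rule arg_cong)
  then show ?thesis using s periodic_int_shift[of x, OF shift, of "t + p / 2" j] by metis
qed

text \<open>A zero of the delayed value would be a critical point of \<open>x\<close>. It is not a local maximum, and if it is a local
  minimum then half a period later there is a local maximum other than \<open>t1\<close> within the same turn.\<close>

lemma delayed_negative_after_max:
  assumes x: "solution r x" "has_minimal_period x p" and nc: "\<not> x constant_on UNIV"
    and max: "\<forall>t. x t \<le> x t1" and t: "t1 < t" "t < t1 + p / 2"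
  shows "x (t - r) < 0"
proof (rule ccontr)
  assume nn: "\<not> x (t - r) < 0"
  have per: "has_period x p" using x(2) by (simp add: has_minimal_period_def)
  then have "p > 0" unfolding has_period_def by blast
  note anti = antiperiod_half_period[OF x nc]
  obtain \<delta> where \<delta>: "\<delta> > 0" "\<forall>s. 0 < s \<and> s < \<delta> \<longrightarrow> x (t1 - s - r) > 0 \<and> x (t1 + s - r) < 0"
    by (rule sign_change_at_max[OF x(1) per nc max])
  define s where "s = t1 + min \<delta> (t - t1) / 2"
  have s: "t1 < s" "s < t" "x (s - r) < 0"
    using \<delta>(2)[rule_format, of "s - t1"] \<delta>(1) t by (auto simp: s_def min_def field_simps)
  obtain c where c: "s - r \<le> c" "c \<le> t - r" "x c = 0"
    using IVT'[of x "s - r" 0 "t - r"] s nn solution_continuous_on[OF x(1)] by force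
  have z: "x (c + r - r) = 0" using c(3) by simp
  have bounds: "t1 < c + r" "c + r < t1 + p / 2" using c s t by auto
  show False
  proof (rule disjE[OF critical_sign_change[OF x(1) per nc z]])
    assume "\<exists>\<delta>>0. \<forall>s. 0 < s \<and> s < \<delta> \<longrightarrow> x (c + r - s - r) > 0 \<and> x (c + r + s - r) < 0"
    then show False using no_second_local_max[OF x nc max, of "c + r"] bounds \<open>p > 0\<close> by auto
  next
    assume "\<exists>\<delta>>0. \<forall>s. 0 < s \<and> s < \<delta> \<longrightarrow> x (c + r - s - r) < 0 \<and> x (c + r + s - r) > 0"
    then obtain \<delta> where \<delta>: "\<delta> > 0" "\<forall>s. 0 < s \<and> s < \<delta> \<longrightarrow> x (c + r - s - r) < 0 \<and> x (c + r + s - r) > 0" by blast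
    have "x (c + r + p / 2 - s - r) > 0 \<and> x (c + r + p / 2 + s - r) < 0" if "0 < s" "s < \<delta>" for s
      using \<delta>(2)[rule_format, of s] that anti[of "c + r - s - r"] anti[of "c + r + s - r"]
      by (simp add: algebra_simps)
    then show False using no_second_local_max[OF x nc max, of "c + r + p / 2" \<delta>] bounds \<open>p > 0\<close> \<delta>(1) by auto
  qed
qed

end

section \<open>The delay is an odd multiple of the quarter period\<close>

text \<open>The first return to zero would be a downward crossing or a tangency.\<close>

lemma positive_after_upward_zeros:
  fixes e :: "real \<Rightarrow> real"
  assumes "\<alpha> < \<beta>" and e': "\<And>t. \<alpha> \<le> t \<Longrightarrow> t \<le> \<beta> \<Longrightarrow> (e has_real_derivative e' t) (at t)"
    and "e \<alpha> = 0" and up: "\<And>t. \<alpha> \<le> t \<Longrightarrow> t \<le> \<beta> \<Longrightarrow> e t = 0 \<Longrightarrow> e' t > 0"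
  shows "e \<beta> > 0"
proof (rule ccontr)
  assume n: "\<not> e \<beta> > 0"
  have "e' \<alpha> > 0" using assms by simp
  then obtain d where d: "d > 0" "\<forall>h>0. h < d \<longrightarrow> e \<alpha> < e (\<alpha> + h)"
    using DERIV_pos_inc_right[OF e'[of \<alpha>]] \<open>\<alpha> < \<beta>\<close> by (meson less_imp_le order_refl)
  have pos: "e t > 0" if "\<alpha> < t" "t < \<alpha> + d" for t
    using d(2)[rule_format, of "t - \<alpha>"] that \<open>e \<alpha> = 0\<close> by simp
  define \<gamma> where "\<gamma> = \<alpha> + min d (\<beta> - \<alpha>) / 2"
  have \<gamma>: "\<alpha> < \<gamma>" "\<gamma> < \<alpha> + d" "\<gamma> < \<beta>" using d(1) \<open>\<alpha> < \<beta>\<close> by (auto simp: \<gamma>_def min_def field_simps)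
  have conte: "continuous_on {\<gamma>..\<beta>} e"
    using \<gamma> by (intro continuous_at_imp_continuous_on ballI DERIV_isCont[OF e']) auto
  define Z where "Z = {t \<in> {\<gamma>..\<beta>}. e t = 0}"
  have "compact Z" unfolding Z_def
    using continuous_closed_preimage_constant[of "{\<gamma>..\<beta>}" e 0] conte
    by (simp add: compact_eq_bounded_closed bounded_subset[of "{\<gamma>..\<beta>}"] subset_iff)
  moreover have "Z \<noteq> {}"
    using IVT2'[of e \<beta> 0 \<gamma>] n pos[of \<gamma>] \<gamma> conte by (force simp: Z_def)
  ultimately obtain z where z: "z \<in> Z" "\<forall>t\<in>Z. z \<le> t"
    using compact_attains_inf[of Z] by auto
  have zz: "\<gamma> < z" "z \<le> \<beta>" "e z = 0" using z(1) pos[of \<gamma>] \<gamma> by (auto simp: Z_def less_le)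
  then have "e' z > 0" using up[of z] \<gamma> by simp
  then obtain d' where d': "d' > 0" "\<forall>h>0. h < d' \<longrightarrow> e (z - h) < e z"
    using DERIV_pos_inc_left[OF e'[of z]] zz \<gamma> by (meson less_imp_le less_trans)
  define s where "s = z - min d' (z - \<gamma>) / 2"
  have s: "\<gamma> < s" "s < z" "e s < 0"
    using d'(2)[rule_format, of "z - s"] d'(1) zz by (auto simp: s_def min_def field_simps)
  obtain t where "\<gamma> \<le> t" "t \<le> s" "e t = 0"
    using IVT2'[of e s 0 \<gamma>] s pos[of \<gamma>] \<gamma> zz continuous_on_subset[OF conte, of "{\<gamma>..s}"] by force
  then show False using z(2) s zz by (auto simp: Z_def)
qed

context symmetric_feedback begin

text \<open>Let \<open>y t = x (t + m)\<close>, so that \<open>x' = f (x, y)\<close> and \<open>y' = - f (y, v)\<close> with \<open>v t = x (t + q)\<close>, \<open>q = 2 * m - h\<close>. If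
  \<open>q > 0\<close>, then \<open>v > x\<close> while \<open>x\<close> increases, hence \<open>y\<close> rises more slowly than for the planar system, where \<open>x\<close>
  stands in place of \<open>v\<close>. The curve \<open>(x, y)\<close> and its mirror image under \<open>(u, v) \<mapsto> (- v, - u)\<close> meet on the antidiagonal.
  Afterwards, seen as graphs over the first coordinate, the curve has too small a slope and the mirror image too large
  a slope, so the mirror image remains above. At time \<open>h - m\<close>, however, \<open>y\<close> attains the maximum of \<open>x\<close>.\<close>

lemma lead_le_quarter_period:
  assumes x: "solution (- m) x" and anti: "\<And>t. x (t + h) = - x t"
    and m: "0 < m" "m < h" and zero: "x m = 0" and pos: "\<And>t. 0 < t \<Longrightarrow> t < h \<Longrightarrow> x (t + m) > 0"
  shows "2 * m \<le> h"
proof (rule ccontr)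
  assume "\<not> 2 * m \<le> h"
  then have hm: "h < 2 * m" by simp
  have D: "(x has_real_derivative f (x t, x (t + m))) (at t)" for t
    using solution_deriv[OF x, of t] by simp
  have inc: "x s < x t" if "0 \<le> s" "s < t" "t \<le> h" for s t
    using that pos by (intro solution_increasing[OF x]) auto
  have inc_iff: "x s < x t \<longleftrightarrow> s < t" if "0 \<le> s" "s \<le> h" "0 \<le> t" "t \<le> h" for s t
    using inc[of s t] inc[of t s] that by (metis linorder_neqE_linordered_idom less_asym)
  have xh: "x h = - x 0" using anti[of 0] by simp
  have x0: "x 0 < 0" using inc[of 0 m] m zero by simp
  define q where "q = 2 * m - h"
  have q: "0 < q" "q < m" using hm m by (auto simp: q_def)
  have twice: "x (t + 2 * m) = - x (t + q)" for t
    using anti[of "t + q"] by (simp add: q_def algebra_simps)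
  obtain t\<^sub>d where td: "0 < t\<^sub>d" "t\<^sub>d < h - m" "x t\<^sub>d = - x (t\<^sub>d + m)"
  proof -
    have "continuous_on {0..h - m} (\<lambda>t. x t + x (t + m))"
      by (intro continuous_intros continuous_on_compose2[OF solution_continuous_on[OF x, of UNIV]]
          solution_continuous_on[OF x]) auto
    moreover have "x (h - m) + x h > 0" using inc[of 0 "h - m"] xh m by simp
    moreover have "x 0 + x (0 + m) < 0" using x0 zero by simp
    ultimately obtain t where t: "0 \<le> t" "t \<le> h - m" "x t + x (t + m) = 0"
      using IVT'[of "\<lambda>t. x t + x (t + m)" 0 0 "h - m"] m by auto
    then have "t \<noteq> 0" "t \<noteq> h - m"
      using \<open>x (h - m) + x h > 0\<close> \<open>x 0 + x (0 + m) < 0\<close> by auto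
    then show ?thesis using that[of t] t by auto
  qed
  \<comment> \<open>The inverse of \<open>x\<close> on \<open>{0..h}\<close>; it turns the mirror image into a graph.\<close>
  define \<psi> where "\<psi> v = (SOME t. 0 \<le> t \<and> t \<le> h \<and> x t = v)" for v
  have \<psi>: "0 \<le> \<psi> v \<and> \<psi> v \<le> h \<and> x (\<psi> v) = v" if "x 0 \<le> v" "v \<le> x h" for v
  proof -
    have "\<exists>t. 0 \<le> t \<and> t \<le> h \<and> x t = v"
      using IVT'[of x 0 v h] that m solution_continuous_on[OF x] by auto
    then show ?thesis unfolding \<psi>_def by (rule someI_ex)
  qed
  have \<psi>x: "\<psi> (x t) = t" if "0 \<le> t" "t \<le> h" for t
  proof -
    have "x 0 \<le> x t" "x t \<le> x h" using inc[of 0 t] inc[of t h] that by (auto simp: le_less)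
    then show ?thesis using \<psi>[of "x t"] inc_iff[of t "\<psi> (x t)"] inc_iff[of "\<psi> (x t)" t] that
      by (metis less_irrefl linorder_neqE_linordered_idom)
  qed
  have \<psi>_inner: "0 < \<psi> v" "\<psi> v < h" if "x 0 < v" "v < x h" for v
    using \<psi>[of v] that by (auto simp: less_le)
  have D\<psi>: "(\<psi> has_real_derivative inverse (f (v, x (\<psi> v + m)))) (at v)" if v: "x 0 < v" "v < x h" for v
  proof (rule DERIV_inverse_function[of x _ \<psi> v "x 0" "x h"])
    have xv: "x (\<psi> v) = v" using \<psi>[of v] v by simp
    show "(x has_real_derivative f (v, x (\<psi> v + m))) (at (\<psi> v))" using D[of "\<psi> v"] xv by simp
    show "f (v, x (\<psi> v + m)) \<noteq> 0" using pos[OF \<psi>_inner[OF v]] by simp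
    show "x (\<psi> y) = y" if "x 0 < y" "y < x h" for y using \<psi>[of y] that by simp
    have "isCont \<psi> (x (\<psi> v))"
      by (rule isCont_inverse_function2[OF \<psi>_inner[OF v]]) (auto simp: \<psi>x solution_cont[OF x])
    then show "isCont \<psi> v" using xv by simp
  qed (use v in auto)
  define T where "T t = \<psi> (- x t)" for t
  have range: "x 0 < - x t" "- x t < x h" "x t < 0" if "t\<^sub>d \<le> t" "t \<le> h - m" for t
    using inc[of t m] inc[of 0 t] that hm m td x0 xh zero by auto
  have T: "x (T t) = - x t" "m < T t" "T t \<le> t\<^sub>d + m" if "t\<^sub>d \<le> t" "t \<le> h - m" for t
  proof -
    show 1: "x (T t) = - x t" using \<psi>[of "- x t"] range[OF that] by (simp add: T_def)
    have T: "0 \<le> T t" "T t \<le> h" using \<psi>[of "- x t"] range[OF that] by (simp_all add: T_def)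
    show "m < T t" using inc_iff[of m "T t"] T m 1 range[OF that] zero by simp
    have "x t\<^sub>d \<le> x t" using inc[of t\<^sub>d t] that td m by (cases "t = t\<^sub>d") auto
    then have "\<not> x (t\<^sub>d + m) < x (T t)" using 1 td by simp
    then show "T t \<le> t\<^sub>d + m" using inc_iff[of "t\<^sub>d + m" "T t"] T td m by simp
  qed
  \<comment> \<open>The mirror image of the time \<open>T t - m\<close> lies over \<open>x t\<close>, and \<open>e\<close> is its height above the curve.\<close>
  define e where "e t = - x (T t - m) - x (t + m)" for t
  define e' where "e' t = f (x (T t - m), x (T t)) * (f (x t, x (t + m)) / f (- x t, x (T t + m))) -
      f (x (t + m), x (t + 2 * m))" for t
  have "e (h - m) > 0"
  proof (rule positive_after_upward_zeros[OF td(2), of e e'])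
    fix t assume t: "t\<^sub>d \<le> t" "t \<le> h - m"
    have DT: "(T has_real_derivative inverse (f (- x t, x (T t + m))) * (- f (x t, x (t + m)))) (at t)"
      unfolding T_def using DERIV_chain[OF D\<psi>[OF range(1,2)[OF t]] DERIV_minus[OF D[of t]]]
      by (simp add: o_def T_def)
    have "((\<lambda>t. x (T t - m)) has_real_derivative f (x (T t - m), x (T t)) *
        (inverse (f (- x t, x (T t + m))) * (- f (x t, x (t + m))))) (at t)"
      using DERIV_chain2[where f = x and g = "\<lambda>t. T t - m" and x = t, OF D DERIV_diff[OF DT DERIV_const[of m]]]
      by simp
    moreover have "((\<lambda>t. x (t + m)) has_real_derivative f (x (t + m), x (t + 2 * m))) (at t)"
      using D[of "t + m"] DERIV_shift[of x _ t m] by (simp add: algebra_simps)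
    ultimately have "(e has_real_derivative - (f (x (T t - m), x (T t)) *
        (inverse (f (- x t, x (T t + m))) * (- f (x t, x (t + m))))) - f (x (t + m), x (t + 2 * m))) (at t)"
      unfolding e_def by (intro DERIV_diff DERIV_minus)
    then show "(e has_real_derivative e' t) (at t)" by (simp add: e'_def divide_inverse mult_ac)
    assume "e t = 0"
    then have x\<tau>: "x (T t - m) = - x (t + m)" by (simp add: e_def)
    have "f (x (T t - m), x (T t)) = - f (x (t + m), x t)"
      using x\<tau> T(1)[OF t] even1 odd2 by simp
    moreover have "x t < 0" using range[OF t] by simp
    ultimately have s1: "f (x (T t - m), x (T t)) > 0" by simp
    have "x (T t - m) < x (T t - m + q)" using T[OF t] q td hm m by (intro inc) (auto simp: q_def)
    then have "- x (T t - m + q) < x (t + m)" using x\<tau> by simp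
    then have "f (x t, - x (T t - m + q)) < f (x t, x (t + m))" by simp
    moreover have "f (- x t, x (T t + m)) = f (x t, - x (T t - m + q))"
      using twice[of "T t - m"] even1 by (simp add: add.commute)
    moreover have s3: "f (- x t, x (T t + m)) > 0" using pos[of "T t"] T[OF t] td m by simp
    ultimately have "f (x t, x (t + m)) / f (- x t, x (T t + m)) > 1" by simp
    then have "f (x (T t - m), x (T t)) * (f (x t, x (t + m)) / f (- x t, x (T t + m))) > f (x (T t - m), x (T t)) * 1"
      using s1 by (rule mult_strict_left_mono)
    moreover have "f (x (t + m), x (t + 2 * m)) < f (x (T t - m), x (T t))"
    proof -
      have "x t < x (t + q)" using t td q m by (intro inc) (auto simp: q_def)
      then have "f (x (t + m), x t) < f (x (t + m), x (t + q))" by simp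
      then show ?thesis
        using \<open>f (x (T t - m), x (T t)) = - f (x (t + m), x t)\<close> twice[of t] odd2 by simp
    qed
    ultimately show "e' t > 0" by (simp add: e'_def)
  next
    have "T t\<^sub>d = t\<^sub>d + m" using \<psi>x[of "t\<^sub>d + m"] td m by (simp add: T_def)
    then show "e t\<^sub>d = 0" using td by (simp add: e_def)
  qed
  moreover have "e (h - m) < 0"
    using inc[of 0 "T (h - m) - m"] T[of "h - m"] td m xh by (simp add: e_def)
  ultimately show False by simp
qed

text \<open>The reflected function \<open>- x (h - t)\<close> solves the same equation with \<open>h - m\<close> in place of \<open>m\<close>, which supplies the opposite
  inequality.\<close>

lemma lead_eq_quarter_period:
  assumes x: "solution (- m) x" and anti: "\<And>t. x (t + h) = - x t"
    and m: "0 < m" "m < h" and zero: "x m = 0" and pos: "\<And>t. 0 < t \<Longrightarrow> t < h \<Longrightarrow> x (t + m) > 0"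
  shows "2 * m = h"
proof -
  define y where "y t = - x (h - t)" for t
  have refl: "x (h - t + m) = - x (m - t)" for t using anti[of "m - t"] by (simp add: algebra_simps)
  have "2 * (h - m) \<le> h"
  proof (rule lead_le_quarter_period[of "h - m" y])
    show "solution (- (h - m)) y" unfolding solution_def
    proof
      fix t
      have "((\<lambda>t. x (h - t)) has_real_derivative f (x (h - t), x (h - t + m)) * (-1)) (at t)"
        using solution_deriv[OF x, of "h - t"] by (intro DERIV_chain2[of x]) (auto intro!: derivative_eq_intros)
      then have "(y has_real_derivative f (x (h - t), x (h - t + m))) (at t)"
        unfolding y_def using DERIV_minus by fastforce
      moreover have "f (x (h - t), x (h - t + m)) = f (y t, y (t - - (h - m)))"
        using refl[of t] by (simp add: y_def even1)
      ultimately show "(y has_real_derivative f (y t, y (t - - (h - m)))) (at t)" by simp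
    qed
    show "y (t + h) = - y t" for t using anti[of "- t"] by (simp add: y_def)
    show "y (t + (h - m)) > 0" if "0 < t" "t < h" for t
      using pos[of "h - t"] refl[of t] that by (simp add: y_def)
  qed (use m zero in \<open>auto simp: y_def\<close>)
  then show ?thesis using lead_le_quarter_period[OF assms] by simp
qed

text \<open>With the time counted from a minimum, \<open>x\<close> increases on \<open>{0..h}\<close> and the delayed value vanishes at \<open>0\<close> and is positive on
  the interior. So the zero \<open>m\<close> of \<open>x\<close> on its way up corresponds to the time \<open>0\<close> of the delayed value, and the delay
  amounts to an advance by \<open>m\<close>. Twice this advance is \<open>h\<close>, and a shift by \<open>h\<close> changes the sign.\<close>

lemma periodic_solution_half_turn:
  assumes x: "solution r x" "has_period x p\<^sub>0" and nc: "\<not> x constant_on UNIV"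
  shows "x (t - 2 * r) = - x t"
proof -
  obtain p where p: "has_minimal_period x p"
    by (rule ex_minimal_period[OF solution_continuous_on[OF x(1)] nc x(2)])
  have per: "has_period x p" using p by (simp add: has_minimal_period_def)
  then have "p > 0" and shift: "\<And>t. x (t + p) = x t" unfolding has_period_def by blast+
  define h where "h = p / 2"
  have h: "h > 0" "p = 2 * h" using \<open>p > 0\<close> by (simp_all add: h_def)
  have anti: "x (t + h) = - x t" for t using antiperiod_half_period[OF x(1) p nc] by (simp add: h_def)
  obtain t1 where max: "\<forall>t. x t \<le> x t1" by (rule periodic_attains_max[OF solution_continuous_on[OF x(1)] per])
  define y where "y t = x (t + (t1 - h))" for t
  have y: "solution r y" unfolding y_def by (rule solution_shift[OF x(1)])
  have antiy: "y (t + h) = - y t" for t using anti[of "t + (t1 - h)"] by (simp add: y_def algebra_simps)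
  have shifty: "y (t + 2 * h) = y t" for t using antiy[of "t + h"] antiy[of t] by (simp add: algebra_simps)
  have pos: "y (t - r) > 0" if "0 < t" "t < h" for t
    using delayed_negative_after_max[OF x(1) p nc max, of "t + t1"] that anti[of "t - r + (t1 - h)"]
    by (simp add: h_def y_def algebra_simps)
  have inc: "y s < y t" if "0 \<le> s" "s < t" "t \<le> h" for s t
    using that pos by (intro solution_increasing[OF y]) auto
  have zr: "y (- r) = 0"
    using delayed_zero_at_max[OF x(1), of t1] max anti[of "t1 - r - h"] by (simp add: y_def algebra_simps)
  have "y 0 < 0" "y h > 0" using inc[of 0 h] antiy[of 0] h by auto
  then obtain m where m: "0 \<le> m" "m \<le> h" "y m = 0"
    using IVT'[of y 0 0 h] solution_continuous_on[OF y] h by auto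
  have m': "0 < m" "m < h" using m \<open>y 0 < 0\<close> \<open>y h > 0\<close> by (auto simp: less_le)
  have zeros: "s = m" if "0 \<le> s" "s \<le> h" "y s = 0" for s
    using inc[of s m] inc[of m s] that m by (metis less_irrefl linorder_neqE_linordered_idom)
  obtain k :: int where k: "0 \<le> - r + of_int k * (2 * h)" "- r + of_int k * (2 * h) < 0 + 2 * h"
    using representative_mod_period[of "2 * h" 0 "- r"] h by auto
  define c where "c = - r + of_int k * (2 * h)"
  have yc: "y (t - r) = y (t + c)" for t
    using periodic_int_shift[of y, OF shifty, of "t - r" k] by (simp add: c_def algebra_simps)
  have "y c = 0" using yc[of 0] zr by simp
  have "c = m"
  proof (cases "c \<le> h")
    case True
    then show ?thesis using zeros[of c] k \<open>y c = 0\<close> by (simp add: c_def)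
  next
    case False
    \<comment> \<open>Here \<open>c\<close> would be the zero on the way down, and the delayed value would start with the wrong sign.\<close>
    then have "c - h = m" using zeros[of "c - h"] antiy[of "c - h"] k \<open>y c = 0\<close> by (simp add: c_def)
    define s where "s = (h - m) / 2"
    have s: "0 < s" "s < h" "s + m < h" using m' by (auto simp: s_def field_simps)
    have "y (s - r) = - y (s + m)" using yc[of s] antiy[of "s + m"] \<open>c - h = m\<close> by (simp add: algebra_simps)
    moreover have "y (s + m) > 0" using inc[of m "s + m"] s m by simp
    ultimately show ?thesis using pos[OF s(1,2)] by simp
  qed
  then have ym: "y (t - r) = y (t + m)" for t using yc by simp
  have "2 * m = h"
  proof (rule lead_eq_quarter_period[of m y])
    show "solution (- m) y" using solution_deriv[OF y] ym by (simp add: solution_def)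
    show "y (t + m) > 0" if "0 < t" "t < h" for t using pos[OF that] ym by simp
  qed (use m m' antiy in auto)
  have "y (s - 2 * r) = - y s" for s
  proof -
    have "y (s - 2 * r) = y (s - r + m)" using ym[of "s - r"] by (simp add: algebra_simps)
    also have "\<dots> = y (s + h)" using ym[of "s + m"] \<open>2 * m = h\<close> by (simp add: algebra_simps)
    finally show ?thesis using antiy by simp
  qed
  from this[of "t - (t1 - h)"] show ?thesis by (simp add: y_def algebra_simps)
qed

end

section \<open>Periodic solutions of the planar system\<close>

context symmetric_feedback begin

lemma ODE_D1: "ODE_solution f u\<^sub>1 u\<^sub>2 \<Longrightarrow> (u\<^sub>1 has_real_derivative f (u\<^sub>1 t, u\<^sub>2 t)) (at t)"
  and ODE_D2: "ODE_solution f u\<^sub>1 u\<^sub>2 \<Longrightarrow> (u\<^sub>2 has_real_derivative - f (u\<^sub>2 t, u\<^sub>1 t)) (at t)"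
  by (simp_all add: ODE_solution_def)

lemma ODE_cont1:
  assumes "ODE_solution f u\<^sub>1 u\<^sub>2" shows "continuous_on S u\<^sub>1"
  by (intro continuous_at_imp_continuous_on ballI DERIV_isCont[OF ODE_D1[OF assms]])

lemma ODE_cont2:
  assumes "ODE_solution f u\<^sub>1 u\<^sub>2" shows "continuous_on S u\<^sub>2"
  by (intro continuous_at_imp_continuous_on ballI DERIV_isCont[OF ODE_D2[OF assms]])

text \<open>Gronwall's argument for the squared distance \<open>N\<close>. The bound on \<open>N'\<close> is two-sided, hence the argument works forwards
  and backwards in time.\<close>

lemma ODE_unique:
  assumes u: "ODE_solution f u\<^sub>1 u\<^sub>2" and v: "ODE_solution f v\<^sub>1 v\<^sub>2"
    and R: "\<And>t. \<bar>u\<^sub>1 t\<bar> \<le> R" "\<And>t. \<bar>u\<^sub>2 t\<bar> \<le> R" "\<And>t. \<bar>v\<^sub>1 t\<bar> \<le> R" "\<And>t. \<bar>v\<^sub>2 t\<bar> \<le> R"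
    and t0: "u\<^sub>1 t0 = v\<^sub>1 t0" "u\<^sub>2 t0 = v\<^sub>2 t0"
  shows "u\<^sub>1 t = v\<^sub>1 t \<and> u\<^sub>2 t = v\<^sub>2 t"
proof -
  obtain L where L: "L > 0" "\<forall>u v u' v'. \<bar>u\<bar> \<le> R \<and> \<bar>v\<bar> \<le> R \<and> \<bar>u'\<bar> \<le> R \<and> \<bar>v'\<bar> \<le> R \<longrightarrow>
      \<bar>f (u, v) - f (u', v')\<bar> \<le> L * (\<bar>u - u'\<bar> + \<bar>v - v'\<bar>)"
    using lipschitz[of R] by blast
  define d\<^sub>1 where "d\<^sub>1 t = u\<^sub>1 t - v\<^sub>1 t" for t
  define d\<^sub>2 where "d\<^sub>2 t = u\<^sub>2 t - v\<^sub>2 t" for t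
  define N where "N t = (d\<^sub>1 t)\<^sup>2 + (d\<^sub>2 t)\<^sup>2" for t
  define N' where "N' t = 2 * d\<^sub>1 t * (f (u\<^sub>1 t, u\<^sub>2 t) - f (v\<^sub>1 t, v\<^sub>2 t))
     + 2 * d\<^sub>2 t * (f (v\<^sub>2 t, v\<^sub>1 t) - f (u\<^sub>2 t, u\<^sub>1 t))" for t
  have DN: "(N has_real_derivative N' t) (at t)" for t
    unfolding N_def N'_def d\<^sub>1_def d\<^sub>2_def
    by (rule derivative_eq_intros ODE_D1[OF u] ODE_D2[OF u] ODE_D1[OF v] ODE_D2[OF v] refl | simp add: algebra_simps)+
  have bound: "\<bar>N' t\<bar> \<le> 4 * L * N t" for t
  proof -
    define s where "s = \<bar>d\<^sub>1 t\<bar> + \<bar>d\<^sub>2 t\<bar>"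
    have "\<bar>f (u\<^sub>1 t, u\<^sub>2 t) - f (v\<^sub>1 t, v\<^sub>2 t)\<bar> \<le> L * s"
      using L(2)[rule_format, of "u\<^sub>1 t" "u\<^sub>2 t" "v\<^sub>1 t" "v\<^sub>2 t"] R by (simp add: s_def d\<^sub>1_def d\<^sub>2_def)
    then have "\<bar>2 * d\<^sub>1 t * (f (u\<^sub>1 t, u\<^sub>2 t) - f (v\<^sub>1 t, v\<^sub>2 t))\<bar> \<le> 2 * \<bar>d\<^sub>1 t\<bar> * (L * s)"
      by (simp add: abs_mult mult_left_mono)
    moreover have "\<bar>f (v\<^sub>2 t, v\<^sub>1 t) - f (u\<^sub>2 t, u\<^sub>1 t)\<bar> \<le> L * s"
      using L(2)[rule_format, of "v\<^sub>2 t" "v\<^sub>1 t" "u\<^sub>2 t" "u\<^sub>1 t"] R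
      by (simp add: s_def d\<^sub>1_def d\<^sub>2_def abs_minus_commute add.commute)
    then have "\<bar>2 * d\<^sub>2 t * (f (v\<^sub>2 t, v\<^sub>1 t) - f (u\<^sub>2 t, u\<^sub>1 t))\<bar> \<le> 2 * \<bar>d\<^sub>2 t\<bar> * (L * s)"
      by (simp add: abs_mult mult_left_mono)
    ultimately have "\<bar>N' t\<bar> \<le> 2 * \<bar>d\<^sub>1 t\<bar> * (L * s) + 2 * \<bar>d\<^sub>2 t\<bar> * (L * s)"
      unfolding N'_def by linarith
    also have "\<dots> = 2 * L * s\<^sup>2" by (simp add: s_def power2_eq_square algebra_simps)
    also have "s\<^sup>2 \<le> 2 * N t"
      using zero_le_power2[of "\<bar>d\<^sub>1 t\<bar> - \<bar>d\<^sub>2 t\<bar>"] by (simp add: s_def N_def power2_eq_square algebra_simps)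
    finally show ?thesis using L(1) by simp
  qed
  have Nz: "N t0 = 0" using t0 by (simp add: N_def d\<^sub>1_def d\<^sub>2_def)
  have DE: "((\<lambda>t. N t * exp (c * t)) has_real_derivative (N' t + c * N t) * exp (c * t)) (at t)" for c t
    by (rule derivative_eq_intros DN refl | simp add: algebra_simps)+
  have "N t \<le> 0"
  proof (cases "t0 \<le> t")
    case True
    have "N t * exp (- (4 * L) * t) \<le> N t0 * exp (- (4 * L) * t0)"
    proof (rule DERIV_nonpos_imp_nonincreasing[OF True])
      fix s
      have "N' s + - (4 * L) * N s \<le> 0" using bound[of s] by simp
      then show "\<exists>y. ((\<lambda>t. N t * exp (- (4 * L) * t)) has_real_derivative y) (at s) \<and> y \<le> 0"
        using DE[of "- (4 * L)" s] by (meson mult_nonpos_nonneg exp_ge_zero)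
    qed
    then show ?thesis using Nz by (simp add: mult_le_0_iff not_le)
  next
    case False
    then have "t \<le> t0" by simp
    have "N t * exp (4 * L * t) \<le> N t0 * exp (4 * L * t0)"
    proof (rule DERIV_nonneg_imp_nondecreasing[OF \<open>t \<le> t0\<close>])
      fix s
      have "N' s + 4 * L * N s \<ge> 0" using bound[of s] by simp
      then show "\<exists>y. ((\<lambda>t. N t * exp (4 * L * t)) has_real_derivative y) (at s) \<and> y \<ge> 0"
        using DE[of "4 * L" s] by (meson mult_nonneg_nonneg exp_ge_zero)
    qed
    then show ?thesis using Nz by (simp add: mult_le_0_iff not_le)
  qed
  then have "d\<^sub>1 t = 0 \<and> d\<^sub>2 t = 0" unfolding N_def by (simp add: sum_power2_le_zero_iff)
  then show ?thesis by (simp add: d\<^sub>1_def d\<^sub>2_def)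
qed

lemma ODE_unique_periodic:
  assumes u: "ODE_solution f u\<^sub>1 u\<^sub>2" "has_period (\<lambda>t. (u\<^sub>1 t, u\<^sub>2 t)) p"
    and v: "ODE_solution f v\<^sub>1 v\<^sub>2" "has_period (\<lambda>t. (v\<^sub>1 t, v\<^sub>2 t)) q"
    and t0: "u\<^sub>1 t0 = v\<^sub>1 t0" "u\<^sub>2 t0 = v\<^sub>2 t0"
  shows "u\<^sub>1 t = v\<^sub>1 t" "u\<^sub>2 t = v\<^sub>2 t"
proof -
  obtain R1 where "\<forall>t. \<bar>u\<^sub>1 t\<bar> \<le> R1"
    using periodic_bounded[OF ODE_cont1[OF u(1)]] u(2) unfolding has_period_pair by blast
  moreover obtain R2 where "\<forall>t. \<bar>u\<^sub>2 t\<bar> \<le> R2"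
    using periodic_bounded[OF ODE_cont2[OF u(1)]] u(2) unfolding has_period_pair by blast
  moreover obtain R3 where "\<forall>t. \<bar>v\<^sub>1 t\<bar> \<le> R3"
    using periodic_bounded[OF ODE_cont1[OF v(1)]] v(2) unfolding has_period_pair by blast
  moreover obtain R4 where "\<forall>t. \<bar>v\<^sub>2 t\<bar> \<le> R4"
    using periodic_bounded[OF ODE_cont2[OF v(1)]] v(2) unfolding has_period_pair by blast
  ultimately have "u\<^sub>1 t = v\<^sub>1 t \<and> u\<^sub>2 t = v\<^sub>2 t"
    by (intro ODE_unique[OF u(1) v(1) _ _ _ _ t0, where R = "max (max R1 R2) (max R3 R4)"]) (simp_all add: le_max_iff_disj)
  then show "u\<^sub>1 t = v\<^sub>1 t" "u\<^sub>2 t = v\<^sub>2 t" by simp_all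
qed

lemma ODE_shift:
  assumes "ODE_solution f u\<^sub>1 u\<^sub>2" shows "ODE_solution f (\<lambda>t. u\<^sub>1 (t + c)) (\<lambda>t. u\<^sub>2 (t + c))"
  using ODE_D1[OF assms] ODE_D2[OF assms] by (simp add: ODE_solution_def DERIV_shift[symmetric])

lemma ODE_minus:
  assumes "ODE_solution f u\<^sub>1 u\<^sub>2" shows "ODE_solution f (\<lambda>t. - u\<^sub>1 t) (\<lambda>t. - u\<^sub>2 t)"
  unfolding ODE_solution_def
  using DERIV_minus[OF ODE_D1[OF assms]] DERIV_minus[OF ODE_D2[OF assms]] by (simp add: even1 odd2)

text \<open>The reflections in the horizontal axis and in the antidiagonal turn solutions into solutions run backwards. By uniqueness
  an orbit that meets the axis of the reflection is symmetric about it.\<close>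

lemma ODE_reflect_axis:
  assumes "ODE_solution f u\<^sub>1 u\<^sub>2" shows "ODE_solution f (\<lambda>t. u\<^sub>1 (c - t)) (\<lambda>t. - u\<^sub>2 (c - t))"
  unfolding ODE_solution_def
  using DERIV_reflect[OF ODE_D1[OF assms]] DERIV_minus[OF DERIV_reflect[OF ODE_D2[OF assms]]]
  by (simp add: even1 odd2)

lemma ODE_reflect_antidiagonal:
  assumes "ODE_solution f u\<^sub>1 u\<^sub>2" shows "ODE_solution f (\<lambda>t. - u\<^sub>2 (c - t)) (\<lambda>t. - u\<^sub>1 (c - t))"
  unfolding ODE_solution_def
  using DERIV_minus[OF DERIV_reflect[OF ODE_D1[OF assms]]] DERIV_minus[OF DERIV_reflect[OF ODE_D2[OF assms]]]
  by (simp add: even1 odd2)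

text \<open>If the maximum of \<open>u\<^sub>1\<close> were negative, then \<open>u\<^sub>2\<close> would increase for ever; if it were zero, the orbit would pass
  through the equilibrium at the origin.\<close>

lemma ODE_max_on_axis:
  assumes "ODE_periodic_solution f u\<^sub>1 u\<^sub>2" and max: "\<forall>t. u\<^sub>1 t \<le> u\<^sub>1 t1"
  shows "u\<^sub>2 t1 = 0" "u\<^sub>1 t1 > 0"
proof -
  have u: "ODE_solution f u\<^sub>1 u\<^sub>2" and nc: "\<not> (\<lambda>t. (u\<^sub>1 t, u\<^sub>2 t)) constant_on UNIV"
    using assms(1) by (simp_all add: ODE_periodic_solution_def)
  obtain p where per: "has_period (\<lambda>t. (u\<^sub>1 t, u\<^sub>2 t)) p" using assms(1) unfolding ODE_periodic_solution_def by blast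
  show z: "u\<^sub>2 t1 = 0"
    using DERIV_local_max[OF ODE_D1[OF u, of t1] zero_less_one] max by simp
  show "u\<^sub>1 t1 > 0"
  proof (rule ccontr)
    assume n: "\<not> u\<^sub>1 t1 > 0"
    show False
    proof (cases "u\<^sub>1 t1 = 0")
      case True
      have zero: "ODE_solution f (\<lambda>t. 0) (\<lambda>t. 0)" "has_period (\<lambda>t::real. (0::real, 0::real)) p"
        using per by (simp_all add: ODE_solution_def has_period_def)
      have "u\<^sub>1 t = 0" "u\<^sub>2 t = 0" for t
        using ODE_unique_periodic[OF u per zero, of t1 t] z True by simp_all
      then show False using nc unfolding constant_on_def by blast
    next
      case False
      then have neg: "u\<^sub>1 t < 0" for t using max n by (meson le_less_trans linorder_neqE_linordered_idom)
      have "p > 0" "u\<^sub>2 (0 + p) = u\<^sub>2 0" using per unfolding has_period_def by blast+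
      have "u\<^sub>2 0 < u\<^sub>2 p"
      proof (rule DERIV_pos_imp_increasing[OF \<open>p > 0\<close>])
        fix t
        show "\<exists>y. (u\<^sub>2 has_real_derivative y) (at t) \<and> 0 < y"
          using ODE_D2[OF u, of t] neg[of t] by (intro exI[of _ "- f (u\<^sub>2 t, u\<^sub>1 t)"]) simp
      qed
      then show False using \<open>u\<^sub>2 (0 + p) = u\<^sub>2 0\<close> by simp
    qed
  qed
qed

text \<open>Starting from the positive horizontal axis at \<open>t1\<close>, the orbit enters the quadrant \<open>u\<^sub>1 > 0 > u\<^sub>2\<close> and first meets the
  antidiagonal at a time \<open>t\<^sub>e\<close>. It is symmetric about both times, and composing the two reflections gives a rotation by a
  quarter turn that takes the time \<open>\<tau> = 2 * (t\<^sub>e - t1)\<close>. The sign of \<open>u\<^sub>1\<close> along the quarters shows that \<open>4 * \<tau>\<close> is the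
  minimal period and not a proper multiple of it.\<close>

lemma ODE_quarter_period:
  assumes "ODE_periodic_solution f u\<^sub>1 u\<^sub>2" and min: "has_minimal_period (\<lambda>t. (u\<^sub>1 t, u\<^sub>2 t)) p"
  shows "u\<^sub>2 t = u\<^sub>1 (t + p / 4)"
proof -
  have u: "ODE_solution f u\<^sub>1 u\<^sub>2" and nc: "\<not> (\<lambda>t. (u\<^sub>1 t, u\<^sub>2 t)) constant_on UNIV"
    using assms(1) by (simp_all add: ODE_periodic_solution_def)
  have per: "has_period (\<lambda>t. (u\<^sub>1 t, u\<^sub>2 t)) p" using min by (simp add: has_minimal_period_def)
  then have "p > 0" and shift1: "\<And>t. u\<^sub>1 (t + p) = u\<^sub>1 t" and shift2: "\<And>t. u\<^sub>2 (t + p) = u\<^sub>2 t"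
    unfolding has_period_def by blast+
  have per1: "has_period u\<^sub>1 p" using per unfolding has_period_pair by blast
  note cont1 = ODE_cont1[OF u] and cont2 = ODE_cont2[OF u]
  obtain t1 where t1: "\<forall>t. u\<^sub>1 t \<le> u\<^sub>1 t1" by (rule periodic_attains_max[OF cont1 per1])
  obtain t2 where t2: "\<forall>t. - u\<^sub>1 t \<le> - u\<^sub>1 t2"
    by (rule periodic_attains_max[OF continuous_on_minus[OF cont1] has_period_minus[OF per1]])
  note max1 = ODE_max_on_axis[OF assms(1) t1]
  have "ODE_periodic_solution f (\<lambda>t. - u\<^sub>1 t) (\<lambda>t. - u\<^sub>2 t)"
  proof -
    have "(\<lambda>t. (u\<^sub>1 t, u\<^sub>2 t)) constant_on UNIV" if "(\<lambda>t. (- u\<^sub>1 t, - u\<^sub>2 t)) constant_on UNIV"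
      using that unfolding constant_on_def by (metis Pair_inject minus_minus)
    moreover have "has_period (\<lambda>t. (- u\<^sub>1 t, - u\<^sub>2 t)) p"
      using has_period_compose[OF per, of "\<lambda>z. (- fst z, - snd z)"] by simp
    ultimately show ?thesis using ODE_minus[OF u] nc unfolding ODE_periodic_solution_def by blast
  qed
  note max2 = ODE_max_on_axis[OF this t2]
  have symm: "u\<^sub>1 (2 * t1 - t) = u\<^sub>1 t" "- u\<^sub>2 (2 * t1 - t) = u\<^sub>2 t" for t
    using ODE_unique_periodic[OF ODE_reflect_axis[OF u, of "2 * t1"] _ u per, of p t1 t]
      has_period_compose[OF has_period_reflect[OF per, of "2 * t1"], of "\<lambda>z. (fst z, - snd z)"] max1 by simp_all
  obtain k :: int where k: "t1 \<le> t2 + of_int k * p" using representative_mod_period[OF \<open>p > 0\<close>] by blast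
  define t2' where "t2' = t2 + of_int k * p"
  have "u\<^sub>1 t2' + u\<^sub>2 t2' < 0"
    using periodic_int_shift[of u\<^sub>1, OF shift1, of t2 k] periodic_int_shift[of u\<^sub>2, OF shift2, of t2 k] max2
    by (simp add: t2'_def)
  define S where "S = {t \<in> {t1..t2'}. u\<^sub>1 t + u\<^sub>2 t = 0}"
  have contS: "continuous_on A (\<lambda>t. u\<^sub>1 t + u\<^sub>2 t)" for A by (intro continuous_intros cont1 cont2)
  have "compact S" unfolding S_def
    using continuous_closed_preimage_constant[of "{t1..t2'}" "\<lambda>t. u\<^sub>1 t + u\<^sub>2 t" 0] contS
    by (simp add: compact_eq_bounded_closed bounded_subset[of "{t1..t2'}"] subset_iff)
  moreover have "S \<noteq> {}"
    using IVT2'[of "\<lambda>t. u\<^sub>1 t + u\<^sub>2 t" t2' 0 t1] \<open>u\<^sub>1 t2' + u\<^sub>2 t2' < 0\<close> max1 k contS by (force simp: S_def t2'_def)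
  ultimately obtain t\<^sub>e where te: "t\<^sub>e \<in> S" "\<forall>t\<in>S. t\<^sub>e \<le> t" using compact_attains_inf[of S] by auto
  have te0: "u\<^sub>1 t\<^sub>e + u\<^sub>2 t\<^sub>e = 0" using te by (simp add: S_def)
  have "t1 < t\<^sub>e" using te(1) max1 by (cases "t1 = t\<^sub>e") (auto simp: S_def)
  have diag: "u\<^sub>1 t + u\<^sub>2 t \<ge> 0" if t: "t1 \<le> t" "t \<le> t\<^sub>e" for t
  proof (rule ccontr)
    assume "\<not> u\<^sub>1 t + u\<^sub>2 t \<ge> 0"
    then obtain s where s: "t1 \<le> s" "s \<le> t" "u\<^sub>1 s + u\<^sub>2 s = 0"
      using IVT2'[of "\<lambda>t. u\<^sub>1 t + u\<^sub>2 t" t 0 t1] t max1 contS by auto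
    then have "s \<in> S" using t te(1) by (simp add: S_def)
    then have "s = t" using te(2) s t by force
    then show False using s \<open>\<not> u\<^sub>1 t + u\<^sub>2 t \<ge> 0\<close> by simp
  qed
  have dec2: "u\<^sub>2 t < u\<^sub>2 s" if "s < t" "\<And>\<tau>. s < \<tau> \<Longrightarrow> \<tau> < t \<Longrightarrow> u\<^sub>1 \<tau> > 0" for s t
  proof (rule DERIV_neg_imp_decreasing_open[OF \<open>s < t\<close>])
    fix \<tau> assume "s < \<tau>" "\<tau> < t"
    then show "\<exists>y. (u\<^sub>2 has_real_derivative y) (at \<tau>) \<and> y < 0"
      using ODE_D2[OF u, of \<tau>] that(2)[of \<tau>] by (intro exI[of _ "- f (u\<^sub>2 \<tau>, u\<^sub>1 \<tau>)"]) simp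
  qed (rule cont2)
  have pos1: "u\<^sub>1 t > 0" if t: "t1 \<le> t" "t \<le> t\<^sub>e" for t
  proof (rule ccontr)
    assume n: "\<not> u\<^sub>1 t > 0"
    define Z where "Z = {s \<in> {t1..t}. u\<^sub>1 s = 0}"
    have "compact Z" unfolding Z_def
      using continuous_closed_preimage_constant[of "{t1..t}" u\<^sub>1 0] cont1
      by (simp add: compact_eq_bounded_closed bounded_subset[of "{t1..t}"] subset_iff)
    moreover have "Z \<noteq> {}"
      using IVT2'[of u\<^sub>1 t 0 t1] n max1 cont1 t by (force simp: Z_def)
    ultimately obtain z where z: "z \<in> Z" "\<forall>s\<in>Z. z \<le> s" using compact_attains_inf[of Z] by auto
    have zz: "t1 < z" "z \<le> t" "u\<^sub>1 z = 0" using z(1) max1 by (auto simp: Z_def less_le)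
    have "u\<^sub>1 s > 0" if s: "t1 < s" "s < z" for s
    proof (rule ccontr)
      assume "\<not> u\<^sub>1 s > 0"
      then obtain s' where "t1 \<le> s'" "s' \<le> s" "u\<^sub>1 s' = 0"
        using IVT2'[of u\<^sub>1 s 0 t1] max1 cont1 s by force
      then show False using z(2) s zz by (force simp: Z_def)
    qed
    then have "u\<^sub>2 z < u\<^sub>2 t1" using zz by (intro dec2)
    then show False using diag[of z] zz t max1 by simp
  qed
  have neg2: "u\<^sub>2 t < 0" if "t1 < t" "t \<le> t\<^sub>e" for t
    using dec2[of t1 t] pos1 that max1 by simp
  have anti: "- u\<^sub>2 (2 * t\<^sub>e - t) = u\<^sub>1 t" "- u\<^sub>1 (2 * t\<^sub>e - t) = u\<^sub>2 t" for t
    using ODE_unique_periodic[OF ODE_reflect_antidiagonal[OF u, of "2 * t\<^sub>e"] _ u per, of p t\<^sub>e t]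
      has_period_compose[OF has_period_reflect[OF per, of "2 * t\<^sub>e"], of "\<lambda>z. (- snd z, - fst z)"] te0 by simp_all
  define \<tau> where "\<tau> = 2 * (t\<^sub>e - t1)"
  have "\<tau> > 0" using \<open>t1 < t\<^sub>e\<close> by (simp add: \<tau>_def)
  have quarter: "u\<^sub>2 t = u\<^sub>1 (t + \<tau>)" for t
    using symm(2)[of t] anti(2)[of "2 * t1 - t"] by (simp add: \<tau>_def algebra_simps)
  have half: "u\<^sub>1 (t + 2 * \<tau>) = - u\<^sub>1 t" for t
  proof -
    have "u\<^sub>1 (t + 2 * \<tau>) = u\<^sub>2 (t + \<tau>)" using quarter[of "t + \<tau>"] by (simp add: algebra_simps)
    also have "\<dots> = - u\<^sub>1 (2 * t\<^sub>e - (t + \<tau>))" using anti(2) by simp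
    also have "2 * t\<^sub>e - (t + \<tau>) = 2 * t1 - t" by (simp add: \<tau>_def)
    finally show ?thesis using symm(1) by simp
  qed
  have pos_right: "u\<^sub>1 t > 0" if "t1 \<le> t" "t < t1 + \<tau>" for t
  proof (cases "t \<le> t\<^sub>e")
    case False
    then show ?thesis using neg2[of "2 * t\<^sub>e - t"] anti(1)[of t] that by (simp add: \<tau>_def)
  qed (use pos1 that in simp)
  have pos: "u\<^sub>1 t > 0" if "t1 - \<tau> < t" "t < t1 + \<tau>" for t
    using pos_right[of t] pos_right[of "2 * t1 - t"] symm(1)[of t] that by (cases "t1 \<le> t") auto
  have full: "(u\<^sub>1 (t + 4 * \<tau>), u\<^sub>2 (t + 4 * \<tau>)) = (u\<^sub>1 t, u\<^sub>2 t)" for t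
  proof -
    have "u\<^sub>1 (t + 4 * \<tau>) = u\<^sub>1 t" for t using half[of "t + 2 * \<tau>"] half[of t] by (simp add: algebra_simps)
    from this[of t] this[of "t + \<tau>"] show ?thesis unfolding quarter by (simp add: algebra_simps)
  qed
  obtain j :: int where j: "4 * \<tau> = of_int j * p"
    by (rule shift_multiple_of_minimal_period[OF min full])
  have "j = 1"
  proof (rule ccontr)
    assume "j \<noteq> 1"
    have "of_int j * p > 0" using j \<open>\<tau> > 0\<close> by linarith
    then have "j > 0" using \<open>p > 0\<close> by (simp add: zero_less_mult_iff)
    then have "2 \<le> j" using \<open>j \<noteq> 1\<close> by simp
    then have "2 * p \<le> of_int j * p" using \<open>p > 0\<close> by (intro mult_right_mono) simp_all
    then have "p / 2 \<le> \<tau>" using j by simp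
    obtain i :: int where i: "t1 - p / 2 \<le> t1 + 2 * \<tau> + of_int i * p" "t1 + 2 * \<tau> + of_int i * p < t1 - p / 2 + p"
      by (rule representative_mod_period[OF \<open>p > 0\<close>])
    have eq: "u\<^sub>1 (t1 + 2 * \<tau> + of_int i * p) < 0"
      using periodic_int_shift[of u\<^sub>1, OF shift1, of "t1 + 2 * \<tau>" i] half[of t1] max1 by simp
    moreover have "u\<^sub>1 (t1 - \<tau>) = 0"
      using half[of "t1 - \<tau>"] symm(1)[of "t1 - \<tau>"] by (simp add: algebra_simps)
    ultimately show False
      using pos[of "t1 + 2 * \<tau> + of_int i * p"] i \<open>p / 2 \<le> \<tau>\<close>
      by (cases "t1 + 2 * \<tau> + of_int i * p = t1 - \<tau>") auto
  qed
  then have "p / 4 = \<tau>" using j by simp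
  then show ?thesis by (simp only: quarter)
qed

text \<open>By uniqueness a periodic solution through \<open>(u\<^sub>1 t1, 0)\<close> is a shift of the given one, so the definite description in the
  period map denotes its minimal period.\<close>

lemma period_map_eq:
  assumes u: "ODE_solution f u\<^sub>1 u\<^sub>2" and min: "has_minimal_period (\<lambda>t. (u\<^sub>1 t, u\<^sub>2 t)) p" and "u\<^sub>2 t1 = 0"
  shows "period_map f (u\<^sub>1 t1) = p"
  unfolding period_map_def
proof (rule the_equality)
  have per: "has_period (\<lambda>t. (u\<^sub>1 t, u\<^sub>2 t)) p" using min by (simp add: has_minimal_period_def)
  have min': "has_minimal_period (\<lambda>t. (u\<^sub>1 (t + t1), u\<^sub>2 (t + t1))) p"
    using min unfolding has_minimal_period_def has_period_shift_iff[of "\<lambda>t. (u\<^sub>1 t, u\<^sub>2 t)" t1] .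
  show "\<exists>v\<^sub>1 v\<^sub>2. ODE_solution f v\<^sub>1 v\<^sub>2 \<and> v\<^sub>1 0 = u\<^sub>1 t1 \<and> v\<^sub>2 0 = 0 \<and> has_minimal_period (\<lambda>t. (v\<^sub>1 t, v\<^sub>2 t)) p"
    using ODE_shift[OF u, of t1] min' \<open>u\<^sub>2 t1 = 0\<close>
    by (intro exI[of _ "\<lambda>t. u\<^sub>1 (t + t1)"] exI[of _ "\<lambda>t. u\<^sub>2 (t + t1)"]) simp
  fix q assume "\<exists>v\<^sub>1 v\<^sub>2. ODE_solution f v\<^sub>1 v\<^sub>2 \<and> v\<^sub>1 0 = u\<^sub>1 t1 \<and> v\<^sub>2 0 = 0 \<and> has_minimal_period (\<lambda>t. (v\<^sub>1 t, v\<^sub>2 t)) q"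
  then obtain v\<^sub>1 v\<^sub>2 where v: "ODE_solution f v\<^sub>1 v\<^sub>2" "v\<^sub>1 0 = u\<^sub>1 t1" "v\<^sub>2 0 = 0"
    "has_minimal_period (\<lambda>t. (v\<^sub>1 t, v\<^sub>2 t)) q" by blast
  have perv: "has_period (\<lambda>t. (v\<^sub>1 t, v\<^sub>2 t)) q" using v(4) by (simp add: has_minimal_period_def)
  have "v\<^sub>1 t = u\<^sub>1 (t + t1)" "v\<^sub>2 t = u\<^sub>2 (t + t1)" for t
    using ODE_unique_periodic[OF v(1) perv ODE_shift[OF u, of t1], of p 0 t]
      has_period_shift[OF per, of t1] v \<open>u\<^sub>2 t1 = 0\<close> by simp_all
  then show "q = p" using has_minimal_period_unique[OF v(4)] min' by simp
qed

end

section \<open>Resonance between the delay and the period\<close>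

context symmetric_feedback begin

text \<open>The quarter-period shift of the planar system must agree with the delay modulo the minimal period.\<close>

lemma periodic_solution_structure:
  assumes x: "solution r x" "has_period x p\<^sub>0" and nc: "\<not> x constant_on UNIV"
    and max: "\<forall>t. x t \<le> x t1"
  shows "has_minimal_period x (period_map f (x t1))"
    and "\<exists>k::int. 4 * r = (4 * of_int k - 1) * period_map f (x t1)"
proof -
  obtain p where p: "has_minimal_period x p"
    by (rule ex_minimal_period[OF solution_continuous_on[OF x(1)] nc x(2)])
  define y where "y t = x (t - r)" for t
  have period_y: "has_period y q" if "has_period x q" for q
    using has_period_shift[OF that, of "- r"] by (simp add: y_def[abs_def])
  have u: "ODE_solution f x y" unfolding ODE_solution_def
  proof (intro allI conjI)
    fix t
    show "(x has_real_derivative f (x t, y t)) (at t)" using solution_deriv[OF x(1)] by (simp add: y_def)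
    have "(y has_real_derivative f (y t, x (t - 2 * r))) (at t)"
      using solution_deriv[OF solution_shift[OF x(1), of "- r"], of t] by (simp add: y_def[abs_def] algebra_simps)
    moreover have "f (y t, x (t - 2 * r)) = - f (y t, x t)"
      using periodic_solution_half_turn[OF x nc, of t] odd2 by simp
    ultimately show "(y has_real_derivative - f (y t, x t)) (at t)" by simp
  qed
  have min: "has_minimal_period (\<lambda>t. (x t, y t)) p"
    using p period_y unfolding has_minimal_period_def has_period_pair by blast
  have nc': "\<not> (\<lambda>t. (x t, y t)) constant_on UNIV"
  proof
    assume "(\<lambda>t. (x t, y t)) constant_on UNIV"
    then obtain c where "\<And>t. (x t, y t) = c" unfolding constant_on_def by blast
    then have "x t = fst c" for t by (metis fst_conv)
    then show False using nc unfolding constant_on_def by blast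
  qed
  have sol: "ODE_periodic_solution f x y"
    using u min nc' unfolding ODE_periodic_solution_def has_minimal_period_def by blast
  have pm: "period_map f (x t1) = p" using period_map_eq[OF u min] ODE_max_on_axis(1)[OF sol max] .
  show "has_minimal_period x (period_map f (x t1))" using p pm by simp
  have shift: "x (t + (r + p / 4)) = x t" for t
    using ODE_quarter_period[OF sol min, of "t + r"] by (simp add: y_def algebra_simps)
  obtain k :: int where "r + p / 4 = of_int k * p" by (rule shift_multiple_of_minimal_period[OF p shift])
  then show "\<exists>k::int. 4 * r = (4 * of_int k - 1) * period_map f (x t1)"
    unfolding pm by (intro exI[of _ k]) (simp add: algebra_simps)
qed

lemma resonant_ODE_solution:
  assumes u: "ODE_periodic_solution f u\<^sub>1 u\<^sub>2" and max: "\<forall>t. u\<^sub>1 t \<le> u\<^sub>1 t1"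
    and r: "4 * r = (4 * of_int k - 1) * period_map f (u\<^sub>1 t1)"
  shows "solution r u\<^sub>1" "has_period u\<^sub>1 (period_map f (u\<^sub>1 t1))" "\<not> u\<^sub>1 constant_on UNIV"
proof -
  have sol: "ODE_solution f u\<^sub>1 u\<^sub>2" and nc: "\<not> (\<lambda>t. (u\<^sub>1 t, u\<^sub>2 t)) constant_on UNIV"
    using u by (simp_all add: ODE_periodic_solution_def)
  obtain p\<^sub>0 where per0: "has_period (\<lambda>t. (u\<^sub>1 t, u\<^sub>2 t)) p\<^sub>0" using u unfolding ODE_periodic_solution_def by blast
  obtain p where min: "has_minimal_period (\<lambda>t. (u\<^sub>1 t, u\<^sub>2 t)) p"
    by (rule ex_minimal_period[OF continuous_on_Pair[OF ODE_cont1[OF sol] ODE_cont2[OF sol]] nc per0])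
  have pm: "period_map f (u\<^sub>1 t1) = p" by (rule period_map_eq[OF sol min ODE_max_on_axis(1)[OF u max]])
  have per: "has_period u\<^sub>1 p" using min unfolding has_minimal_period_def has_period_pair by blast
  then show "has_period u\<^sub>1 (period_map f (u\<^sub>1 t1))" by (simp add: pm)
  have quarter: "u\<^sub>2 t = u\<^sub>1 (t + p / 4)" for t by (rule ODE_quarter_period[OF u min])
  have "u\<^sub>2 t = u\<^sub>1 (t - r)" for t
  proof -
    have "t + p / 4 = (t - r) + of_int k * p" using r unfolding pm by (simp add: field_simps)
    then have "u\<^sub>1 (t + p / 4) = u\<^sub>1 (t - r)"
      using periodic_int_shift[of u\<^sub>1 p "t - r" k] per unfolding has_period_def by metis
    then show ?thesis by (simp only: quarter)
  qed
  then show "solution r u\<^sub>1" using ODE_D1[OF sol] by (simp add: solution_def)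
  show "\<not> u\<^sub>1 constant_on UNIV"
  proof
    assume "u\<^sub>1 constant_on UNIV"
    then obtain c where "\<And>t. u\<^sub>1 t = c" unfolding constant_on_def by blast
    then have "(u\<^sub>1 t, u\<^sub>2 t) = (c, c)" for t by (simp only: quarter)
    then show False using nc unfolding constant_on_def by blast
  qed
qed

end

section \<open>Both signs of the feedback\<close>

lemma C2_lipschitz_on_box:
  fixes f :: "real \<times> real \<Rightarrow> real"
  assumes "C2 f"
  shows "\<exists>L>0. \<forall>u v u' v'. \<bar>u\<bar> \<le> R \<and> \<bar>v\<bar> \<le> R \<and> \<bar>u'\<bar> \<le> R \<and> \<bar>v'\<bar> \<le> R \<longrightarrow>
          \<bar>f (u, v) - f (u', v')\<bar> \<le> L * (\<bar>u - u'\<bar> + \<bar>v - v'\<bar>)"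
proof -
  obtain f' :: "real \<times> real \<Rightarrow> ((real \<times> real) \<Rightarrow>\<^sub>L real)" and f'' where
    f': "\<And>u. (f has_derivative blinfun_apply (f' u)) (at u)" and
    f'': "\<And>u. (f' has_derivative blinfun_apply (f'' u)) (at u)"
    using assms unfolding C2_def by blast
  define S where "S = {-R..R} \<times> {-R..R}"
  have "compact S" "convex S" unfolding S_def by (auto intro: compact_Times convex_Times)
  have "isCont f' u" for u by (rule has_derivative_continuous[OF f''])
  then have "continuous_on S f'" by (simp add: continuous_at_imp_continuous_on)
  then have "bounded (f' ` S)" using \<open>compact S\<close> compact_continuous_image compact_imp_bounded by blast
  then obtain L where L: "L > 0" "\<forall>z\<in>f' ` S. norm z \<le> L" unfolding bounded_pos by blast
  have "\<bar>f (u, v) - f (u', v')\<bar> \<le> L * (\<bar>u - u'\<bar> + \<bar>v - v'\<bar>)"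
    if "\<bar>u\<bar> \<le> R" "\<bar>v\<bar> \<le> R" "\<bar>u'\<bar> \<le> R" "\<bar>v'\<bar> \<le> R" for u v u' v'
  proof -
    have "norm (f (u, v) - f (u', v')) \<le> L * norm ((u, v) - (u', v'))"
    proof (rule differentiable_bound[OF \<open>convex S\<close>, of f "\<lambda>z. blinfun_apply (f' z)"])
      show "(f has_derivative blinfun_apply (f' z)) (at z within S)" for z
        using f' by (rule has_derivative_at_withinI)
      show "onorm (blinfun_apply (f' z)) \<le> L" if "z \<in> S" for z
        using L(2) that by (simp add: norm_blinfun.rep_eq[symmetric])
    qed (use that in \<open>auto simp: S_def abs_le_iff\<close>)
    also have "norm ((u, v) - (u', v')) \<le> \<bar>u - u'\<bar> + \<bar>v - v'\<bar>"
      using sqrt_sum_squares_le_sum_abs[of "u - u'" "v - v'"] by (simp add: norm_Pair)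
    finally show ?thesis using L(1) by simp
  qed
  then show ?thesis using L(1) by blast
qed

lemma X_plus_symmetric_feedback:
  assumes "f \<in> X_plus"
  shows "symmetric_feedback f"
proof
  have C2: "C2 f" and X: "\<And>u v. f (u, v) = f (- u, v)" "\<And>u v. f (u, v) = - f (u, - v)"
    "\<And>u v. deriv (\<lambda>v. f (u, v)) v > 0"
    using assms unfolding X_plus_def by blast+
  show "f (- u, v) = f (u, v)" for u v using X(1)[of u v] by simp
  show "f (u, - v) = - f (u, v)" for u v using X(2)[of u v] by simp
  obtain f' :: "real \<times> real \<Rightarrow> ((real \<times> real) \<Rightarrow>\<^sub>L real)" where
    f': "\<And>u. (f has_derivative blinfun_apply (f' u)) (at u)"
    using C2 unfolding C2_def by blast
  show "continuous_on UNIV f"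
    using has_derivative_continuous[OF f'] by (simp add: continuous_at_imp_continuous_on)
  show "\<exists>L>0. \<forall>u v u' v'. \<bar>u\<bar> \<le> R \<and> \<bar>v\<bar> \<le> R \<and> \<bar>u'\<bar> \<le> R \<and> \<bar>v'\<bar> \<le> R \<longrightarrow>
          \<bar>f (u, v) - f (u', v')\<bar> \<le> L * (\<bar>u - u'\<bar> + \<bar>v - v'\<bar>)" for R
    by (rule C2_lipschitz_on_box[OF C2])
  fix u v v' :: real assume "v < v'"
  have "((\<lambda>v. f (u, v)) has_real_derivative deriv (\<lambda>v. f (u, v)) w) (at w)" for w
  proof -
    have "((\<lambda>v. f (u, v)) has_derivative (\<lambda>h. blinfun_apply (f' (u, w)) (0, h))) (at w)"
      using has_derivative_compose[OF has_derivative_Pair[OF has_derivative_const has_derivative_ident] f', of u w] by simp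
    then have "(\<lambda>v. f (u, v)) differentiable (at w)" by (rule differentiableI)
    then show ?thesis by (simp add: DERIV_deriv_iff_real_differentiable)
  qed
  then show "f (u, v) < f (u, v')"
    using X(3) by (intro DERIV_pos_imp_increasing[OF \<open>v < v'\<close>]) blast
qed

lemma reverse_time_DERIV:
  fixes x :: "real \<Rightarrow> real"
  shows "(\<forall>t. ((\<lambda>t. x (- t)) has_real_derivative D t) (at t)) \<longleftrightarrow> (\<forall>t. (x has_real_derivative - D (- t)) (at t))"
proof -
  have "((\<lambda>t. x (- t)) has_real_derivative D t) (at t) \<longleftrightarrow> (x has_real_derivative - D t) (at (- t))" for t
    using DERIV_mirror[of x "- D t" t] by simp
  then show ?thesis by (metis minus_minus)
qed

lemma ODE_solution_reverse:
  "ODE_solution (\<lambda>u. - g u) u\<^sub>1 u\<^sub>2 \<longleftrightarrow> ODE_solution g (\<lambda>t. u\<^sub>1 (- t)) (\<lambda>t. u\<^sub>2 (- t))"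
  using reverse_time_DERIV[of u\<^sub>1 "\<lambda>t. g (u\<^sub>1 (- t), u\<^sub>2 (- t))"] reverse_time_DERIV[of u\<^sub>2 "\<lambda>t. - g (u\<^sub>2 (- t), u\<^sub>1 (- t))"]
  unfolding ODE_solution_def by auto

lemma has_minimal_period_reverse: "has_minimal_period (\<lambda>t::real. x (- t)) p \<longleftrightarrow> has_minimal_period x p"
proof -
  have "has_period (\<lambda>t::real. x (- t)) p \<longleftrightarrow> has_period x p" for p
    using has_period_reflect[of x p 0] has_period_reflect[of "\<lambda>t. x (- t)" p 0] by auto
  then show ?thesis unfolding has_minimal_period_def by simp
qed

text \<open>Time reversal is a bijection between the solutions through \<open>(a, 0)\<close> at time \<open>0\<close> of both systems and keeps the minimal
  periods.\<close>

lemma period_map_reverse: "period_map (\<lambda>u. - g u) a = period_map g a"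
proof -
  have "(\<exists>u\<^sub>1 u\<^sub>2. ODE_solution (\<lambda>u. - g u) u\<^sub>1 u\<^sub>2 \<and> u\<^sub>1 0 = a \<and> u\<^sub>2 0 = 0 \<and> has_minimal_period (\<lambda>t. (u\<^sub>1 t, u\<^sub>2 t)) p) \<longleftrightarrow>
    (\<exists>u\<^sub>1 u\<^sub>2. ODE_solution g u\<^sub>1 u\<^sub>2 \<and> u\<^sub>1 0 = a \<and> u\<^sub>2 0 = 0 \<and> has_minimal_period (\<lambda>t. (u\<^sub>1 t, u\<^sub>2 t)) p)"
    (is "(\<exists>u\<^sub>1 u\<^sub>2. ?A u\<^sub>1 u\<^sub>2) \<longleftrightarrow> (\<exists>u\<^sub>1 u\<^sub>2. ?B u\<^sub>1 u\<^sub>2)") for p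
  proof
    have eq: "?A u\<^sub>1 u\<^sub>2 \<longleftrightarrow> ?B (\<lambda>t. u\<^sub>1 (- t)) (\<lambda>t. u\<^sub>2 (- t))" for u\<^sub>1 u\<^sub>2
      using ODE_solution_reverse[of g u\<^sub>1 u\<^sub>2] has_minimal_period_reverse[of "\<lambda>t. (u\<^sub>1 t, u\<^sub>2 t)" p] by simp
    show "\<exists>u\<^sub>1 u\<^sub>2. ?B u\<^sub>1 u\<^sub>2" if "\<exists>u\<^sub>1 u\<^sub>2. ?A u\<^sub>1 u\<^sub>2" using that unfolding eq by blast
    assume "\<exists>u\<^sub>1 u\<^sub>2. ?B u\<^sub>1 u\<^sub>2"
    then obtain u\<^sub>1 u\<^sub>2 where "?B u\<^sub>1 u\<^sub>2" by blast
    then have "?A (\<lambda>t. u\<^sub>1 (- t)) (\<lambda>t. u\<^sub>2 (- t))" using eq[of "\<lambda>t. u\<^sub>1 (- t)" "\<lambda>t. u\<^sub>2 (- t)"] by simp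
    then show "\<exists>u\<^sub>1 u\<^sub>2. ?A u\<^sub>1 u\<^sub>2" by blast
  qed
  then show ?thesis unfolding period_map_def by simp
qed

lemma maximum_on_eq:
  assumes "t \<in> S" and "\<forall>s\<in>S. x s \<le> x t"
  shows "maximum_on S x = x t"
  unfolding maximum_on_def using assms by (intro Greatest_equality) auto

lemma maximum_on_period_eq:
  assumes per: "has_period x p" and max: "\<forall>s. x s \<le> x t"
  shows "maximum_on {0..p} x = x t"
proof -
  have "p > 0" and shift: "\<And>t. x (t + p) = x t" using per unfolding has_period_def by blast+
  obtain k :: int where k: "0 \<le> t + of_int k * p" "t + of_int k * p < 0 + p"
    by (rule representative_mod_period[OF \<open>p > 0\<close>])
  have eq: "x (t + of_int k * p) = x t" by (rule periodic_int_shift[of x, OF shift])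
  show ?thesis
    using maximum_on_eq[of "t + of_int k * p" "{0..p}" x] k max by (simp add: eq)
qed

lemma period_four_of_half_turn:
  fixes x :: "real \<Rightarrow> real"
  assumes "\<And>t. x (t - 2) = - x t" shows "has_period x 4"
  unfolding has_period_def
proof (intro conjI allI)
  show "x (t + 4) = x t" for t using assms[of "t + 4"] assms[of "t + 2"] by (simp add: add.commute)
qed simp

lemma resonance_delay_one:
  assumes "4 * 1 = (4 * of_int k - 1) * p" and "p > (0::real)"
  shows "\<exists>n::nat. n \<ge> 1 \<and> p = 4 / (4 * real n - 1)"
proof -
  have "k \<ge> 1"
  proof (rule ccontr)
    assume "\<not> k \<ge> 1"
    then have "(4 * of_int k - 1) * p \<le> 0" using \<open>p > 0\<close> by (intro mult_nonpos_nonneg) simp_all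
    then show False using assms(1) by simp
  qed
  moreover have "p = 4 / (4 * of_int k - 1)" using assms(1) \<open>k \<ge> 1\<close> by (simp add: eq_divide_eq mult.commute)
  ultimately show ?thesis by (intro exI[of _ "nat k"]) auto
qed

lemma resonance_delay_minus_one:
  assumes "4 * (-1) = (4 * of_int k - 1) * p" and "p > (0::real)"
  shows "\<exists>n::nat. n \<ge> 1 \<and> p = 4 / (4 * real n - 3)"
proof -
  have "k \<le> 0"
  proof (rule ccontr)
    assume "\<not> k \<le> 0"
    then have "(4 * of_int k - 1) * p \<ge> 0" using \<open>p > 0\<close> by (intro mult_nonneg_nonneg) simp_all
    then show False using assms(1) by simp
  qed
  then have n: "real (nat (1 - k)) = 1 - of_int k" by simp
  have "real_of_int k \<le> 0" using \<open>k \<le> 0\<close> by simp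
  then have "p = 4 / (4 * (1 - of_int k) - 3)" using assms(1) by (simp add: eq_divide_eq algebra_simps)
  then show ?thesis using \<open>k \<le> 0\<close> by (intro exI[of _ "nat (1 - k)"]) (simp add: n)
qed

lemma DDE_X_plus:
  assumes f: "f \<in> X_plus" and x: "DDE_periodic_solution f x"
  defines "xbar \<equiv> maximum_on {0..4} x"
  shows "(\<forall>t. x (t - 2) = - x t) \<and> has_minimal_period x (period_map f xbar) \<and>
    (\<exists>n::nat. n \<ge> 1 \<and> period_map f xbar = 4 / (4 * real n - 1))"
proof -
  interpret symmetric_feedback f by (rule X_plus_symmetric_feedback[OF f])
  have sol: "solution 1 x" and nc: "\<not> x constant_on UNIV" and "\<exists>p. has_period x p"
    using x unfolding DDE_periodic_solution_def solution_def by blast+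
  then obtain p where p: "has_period x p" by blast
  obtain t1 where max: "\<forall>t. x t \<le> x t1" by (rule periodic_attains_max[OF solution_continuous_on[OF sol] p])
  have turn: "x (t - 2) = - x t" for t using periodic_solution_half_turn[OF sol p nc, of t] by simp
  then have "xbar = x t1"
    unfolding xbar_def by (intro maximum_on_period_eq max period_four_of_half_turn)
  then show ?thesis
    using periodic_solution_structure[OF sol p nc max] turn resonance_delay_one
    unfolding has_minimal_period_def has_period_def by auto
qed

lemma DDE_reverse:
  assumes "DDE_periodic_solution (\<lambda>u. - g u) x" and "symmetric_feedback g"
  shows "symmetric_feedback.solution g (-1) (\<lambda>t. x (- t))"
  unfolding symmetric_feedback.solution_def[OF assms(2)]
  by (rule reverse_time_DERIV[THEN iffD2]) (use assms(1) in \<open>simp add: DDE_periodic_solution_def\<close>)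

text \<open>The reversed solution has feedback \<open>g \<in> X_plus\<close> and delay \<open>- 1\<close>.\<close>

lemma DDE_X_minus:
  assumes f: "f \<in> X_minus" and x: "DDE_periodic_solution f x"
  defines "xbar \<equiv> maximum_on {0..4} x"
  shows "(\<forall>t. x (t - 2) = - x t) \<and> has_minimal_period x (period_map f xbar) \<and>
    (\<exists>n::nat. n \<ge> 1 \<and> period_map f xbar = 4 / (4 * real n - 3))"
proof -
  obtain g where g: "g \<in> X_plus" and fg: "f = (\<lambda>u. - g u)" using f unfolding X_minus_def by blast
  interpret symmetric_feedback g by (rule X_plus_symmetric_feedback[OF g])
  define y where "y t = x (- t)" for t
  have sol: "solution (-1) y"
    using DDE_reverse[OF x[unfolded fg] symmetric_feedback_axioms] by (simp add: y_def[abs_def])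
  have nc: "\<not> y constant_on UNIV"
  proof
    assume "y constant_on UNIV"
    then obtain c where "\<And>t. y t = c" unfolding constant_on_def by blast
    from this[of "- _"] have "x t = c" for t by (simp add: y_def)
    then show False using x unfolding DDE_periodic_solution_def constant_on_def by blast
  qed
  obtain p where "has_period x p" using x unfolding DDE_periodic_solution_def by blast
  then have p: "has_period y p" using has_period_reflect[of x p 0] by (simp add: y_def[abs_def])
  obtain t1 where max: "\<forall>t. y t \<le> y t1" by (rule periodic_attains_max[OF solution_continuous_on[OF sol] p])
  have turn: "x (t - 2) = - x t" for t
    using periodic_solution_half_turn[OF sol p nc, of "- t"] by (simp add: y_def)
  have "x t \<le> x (- t1)" for t using max[rule_format, of "- t"] by (simp add: y_def)
  then have "xbar = y t1" unfolding y_def xbar_def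
    by (intro maximum_on_period_eq allI period_four_of_half_turn turn)
  then have pm: "period_map f xbar = period_map g (y t1)" by (simp add: fg period_map_reverse)
  note str = periodic_solution_structure[OF sol p nc max]
  have min: "has_minimal_period x (period_map f xbar)"
    using str(1) has_minimal_period_reverse[of x] unfolding pm by (simp add: y_def[abs_def])
  moreover have "\<exists>n::nat. n \<ge> 1 \<and> period_map f xbar = 4 / (4 * real n - 3)"
  proof -
    obtain k :: int where "4 * (-1) = (4 * of_int k - 1) * period_map f xbar" using str(2) unfolding pm by blast
    moreover have "period_map f xbar > 0" using min by (simp add: has_minimal_period_def has_period_def)
    ultimately show ?thesis by (rule resonance_delay_minus_one)
  qed
  ultimately show ?thesis using turn by blast
qed

lemma ODE_attains_max:
  assumes "ODE_periodic_solution f u\<^sub>1 u\<^sub>2"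
  obtains t1 where "\<forall>t. u\<^sub>1 t \<le> u\<^sub>1 t1" "maximum_on UNIV u\<^sub>1 = u\<^sub>1 t1"
proof -
  have "continuous_on UNIV u\<^sub>1"
    using assms unfolding ODE_periodic_solution_def ODE_solution_def
    by (meson DERIV_isCont continuous_at_imp_continuous_on)
  moreover obtain p where "has_period u\<^sub>1 p"
    using assms unfolding ODE_periodic_solution_def has_period_pair by blast
  ultimately obtain t1 where "\<forall>t. u\<^sub>1 t \<le> u\<^sub>1 t1" by (rule periodic_attains_max)
  then show ?thesis using that maximum_on_eq[of t1 UNIV u\<^sub>1] by simp
qed

lemma resonant_ODE_X_plus:
  assumes f: "f \<in> X_plus" and u: "ODE_periodic_solution f u\<^sub>1 u\<^sub>2"
    and n: "n \<ge> 1" "period_map f (maximum_on UNIV u\<^sub>1) = 4 / (4 * real n - 1)"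
  shows "DDE_periodic_solution f u\<^sub>1"
proof -
  interpret symmetric_feedback f by (rule X_plus_symmetric_feedback[OF f])
  obtain t1 where max: "\<forall>t. u\<^sub>1 t \<le> u\<^sub>1 t1" "maximum_on UNIV u\<^sub>1 = u\<^sub>1 t1" by (rule ODE_attains_max[OF u])
  have "real n \<ge> 1" using n(1) by simp
  then have "4 * real n - 1 \<noteq> 0" by linarith
  then have "4 * 1 = (4 * of_int (int n) - 1) * period_map f (u\<^sub>1 t1)"
    using n(2) max(2) by (simp add: field_simps)
  from resonant_ODE_solution[OF u max(1) this] show ?thesis
    unfolding DDE_periodic_solution_def solution_def by blast
qed

lemma resonant_ODE_X_minus:
  assumes f: "f \<in> X_minus" and u: "ODE_periodic_solution f u\<^sub>1 u\<^sub>2"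
    and n: "n \<ge> 1" "period_map f (maximum_on UNIV u\<^sub>1) = 4 / (4 * real n - 3)"
  shows "DDE_periodic_solution f u\<^sub>1"
proof -
  obtain g where g: "g \<in> X_plus" and fg: "f = (\<lambda>u. - g u)" using f unfolding X_minus_def by blast
  interpret symmetric_feedback g by (rule X_plus_symmetric_feedback[OF g])
  obtain t1 where max: "\<forall>t. u\<^sub>1 t \<le> u\<^sub>1 t1" "maximum_on UNIV u\<^sub>1 = u\<^sub>1 t1" by (rule ODE_attains_max[OF u])
  define v\<^sub>1 where "v\<^sub>1 t = u\<^sub>1 (- t)" for t
  define v\<^sub>2 where "v\<^sub>2 t = u\<^sub>2 (- t)" for t
  have v: "ODE_periodic_solution g v\<^sub>1 v\<^sub>2" unfolding ODE_periodic_solution_def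
  proof (intro conjI)
    show "ODE_solution g v\<^sub>1 v\<^sub>2"
      using u ODE_solution_reverse[of g u\<^sub>1 u\<^sub>2] by (simp add: ODE_periodic_solution_def fg v\<^sub>1_def[abs_def] v\<^sub>2_def[abs_def])
    obtain p where "has_period (\<lambda>t. (u\<^sub>1 t, u\<^sub>2 t)) p" using u unfolding ODE_periodic_solution_def by blast
    from has_period_reflect[OF this, of 0] show "\<exists>p. has_period (\<lambda>t. (v\<^sub>1 t, v\<^sub>2 t)) p"
      by (auto simp: v\<^sub>1_def v\<^sub>2_def)
    show "\<not> (\<lambda>t. (v\<^sub>1 t, v\<^sub>2 t)) constant_on UNIV"
    proof
      assume "(\<lambda>t. (v\<^sub>1 t, v\<^sub>2 t)) constant_on UNIV"
      then obtain c where c: "\<And>t. (v\<^sub>1 t, v\<^sub>2 t) = c" unfolding constant_on_def by blast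
      have "(u\<^sub>1 t, u\<^sub>2 t) = c" for t using c[of "- t"] by (simp add: v\<^sub>1_def v\<^sub>2_def)
      then show False using u unfolding ODE_periodic_solution_def constant_on_def by blast
    qed
  qed
  have maxv: "\<forall>t. v\<^sub>1 t \<le> v\<^sub>1 (- t1)" using max(1) by (simp add: v\<^sub>1_def)
  have "real n \<ge> 1" using n(1) by simp
  then have "4 * real n - 3 \<noteq> 0" by linarith
  then have "4 * (-1) = (4 * of_int (1 - int n) - 1) * period_map g (v\<^sub>1 (- t1))"
    using n(2) max(2) by (simp add: fg period_map_reverse v\<^sub>1_def field_simps)
  note res = resonant_ODE_solution[OF v maxv this]
  have "\<forall>t. (u\<^sub>1 has_real_derivative f (u\<^sub>1 t, u\<^sub>1 (t - 1))) (at t)"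
  proof -
    have "\<forall>t. ((\<lambda>t. u\<^sub>1 (- t)) has_real_derivative g (u\<^sub>1 (- t), u\<^sub>1 (- t - 1))) (at t)"
      using res(1) by (simp add: solution_def v\<^sub>1_def[abs_def] algebra_simps)
    from this[THEN reverse_time_DERIV[THEN iffD1]] show ?thesis by (simp add: fg)
  qed
  moreover have "\<not> u\<^sub>1 constant_on UNIV"
  proof
    assume "u\<^sub>1 constant_on UNIV"
    then have "v\<^sub>1 constant_on UNIV" unfolding constant_on_def v\<^sub>1_def by blast
    then show False using res(3) by blast
  qed
  moreover have "\<exists>p. has_period u\<^sub>1 p"
    using u unfolding ODE_periodic_solution_def has_period_pair by blast
  ultimately show ?thesis unfolding DDE_periodic_solution_def by blast
qed

theorem theorem1p2:
  fixes f :: "real \<times> real \<Rightarrow> real"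
  assumes "f \<in> X_class"
    and "locally_nonconstant (period_map f)"
  shows "(\<forall>x. DDE_periodic_solution f x \<longrightarrow>
            has_period x 4 \<and> (\<forall>t. x (t - 2) = - x t) \<and>
            (let xbar = maximum_on {0..4} x in
               has_minimal_period x (period_map f xbar) \<and>
               (f \<in> X_plus \<longrightarrow> (\<exists>n::nat. n \<ge> 1 \<and> period_map f xbar = 4 / (4 * real n - 1))) \<and>
               (f \<in> X_minus \<longrightarrow> (\<exists>n::nat. n \<ge> 1 \<and> period_map f xbar = 4 / (4 * real n - 3)))))
       \<and> (\<forall>u\<^sub>1 u\<^sub>2. ODE_periodic_solution f u\<^sub>1 u\<^sub>2 \<longrightarrow>
            (let a = maximum_on UNIV u\<^sub>1 in
               (f \<in> X_plus \<and> (\<exists>n::nat. n \<ge> 1 \<and> period_map f a = 4 / (4 * real n - 1)) \<or>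
                f \<in> X_minus \<and> (\<exists>n::nat. n \<ge> 1 \<and> period_map f a = 4 / (4 * real n - 3)))
               \<longrightarrow> DDE_periodic_solution f u\<^sub>1))"
proof (intro conjI allI impI)
  fix x assume x: "DDE_periodic_solution f x"
  have turn: "\<forall>t. x (t - 2) = - x t" and min: "has_minimal_period x (period_map f (maximum_on {0..4} x))"
    using assms(1) DDE_X_plus[OF _ x] DDE_X_minus[OF _ x] unfolding X_class_def by blast+
  show "has_period x 4" using turn by (intro period_four_of_half_turn) blast
  show "x (t - 2) = - x t" for t using turn by blast
  show "let xbar = maximum_on {0..4} x in
               has_minimal_period x (period_map f xbar) \<and>
               (f \<in> X_plus \<longrightarrow> (\<exists>n::nat. n \<ge> 1 \<and> period_map f xbar = 4 / (4 * real n - 1))) \<and>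
               (f \<in> X_minus \<longrightarrow> (\<exists>n::nat. n \<ge> 1 \<and> period_map f xbar = 4 / (4 * real n - 3)))"
    unfolding Let_def using min DDE_X_plus[OF _ x] DDE_X_minus[OF _ x] by blast
next
  fix u\<^sub>1 u\<^sub>2 assume u: "ODE_periodic_solution f u\<^sub>1 u\<^sub>2"
  show "let a = maximum_on UNIV u\<^sub>1 in
               (f \<in> X_plus \<and> (\<exists>n::nat. n \<ge> 1 \<and> period_map f a = 4 / (4 * real n - 1)) \<or>
                f \<in> X_minus \<and> (\<exists>n::nat. n \<ge> 1 \<and> period_map f a = 4 / (4 * real n - 3)))
               \<longrightarrow> DDE_periodic_solution f u\<^sub>1"
    unfolding Let_def using resonant_ODE_X_plus[OF _ u] resonant_ODE_X_minus[OF _ u] by blast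
qed

end
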